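(* Let $K$ be a finite skew brace and let $G=A\times_{(\alpha,\mu)}K$ and $H=B\times_{(\beta,\nu)}K$ be two brace extensions of $K$ by abelian groups $A$ and $B$, corresponding to cohomology classes $[(\alpha,\mu)]\in\mathrm{H}^2_b(K,A)$ and $[(\beta,\nu)]\in\mathrm{H}^2_b(K,B)$ (trivial action), respectively. Let $\xi:G/A\to H/B$ be a brace isomorphism with $\xi(A(1,k))=B(1,k)$ for all $k\in K$. Then the following are equivalent: (1) There exists a brace isomorphism $\theta:\Gamma_2(G)\to\Gamma_2(H)$ such that $\theta\circ\phi^G_{\cdot}=\phi^H_{\cdot}\circ(\xi\times\xi)$ and $\theta\circ\phi^G_{*}=\phi^H_{*}\circ(\xi\times\xi)$ as maps $(G/A)^2\to\Gamma_2(H)$. (2) $\varepsilon_G(\hat A)=\varepsilon_H(\hat B)$ (as subgroups of $\mathrm{H}^2_b(K,\mathbb{C}^\times)$).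
   Context: A skew (left) brace is a set $A$ with two group structures $(A,\cdot)$, $(A,\circ)$ such that $a\circ(b\cdot c)=(a\circ b)\cdot a^{-1}\cdot(a\circ c)$ for all $a,b,c$, where $a^{-1}$ is the inverse in $(A,\cdot)$. The two identities coincide, denoted $1$. Put $\lambda_a(b)=a^{-1}\cdot(a\circ b)$, $a*b=\lambda_a(b)\cdot b^{-1}$, $[a,b]^{\cdot}=a\cdot b\cdot a^{-1}\cdot b^{-1}$. Brace homomorphisms preserve both operations. An abelian group is viewed as a trivial brace (both operations equal). An ideal is a subgroup of $(A,\cdot)$ stable under all $\lambda_a$ and normal in both groups. $\mathrm{Ann}(A)=\{a: a*b=b*a=[a,b]^{\cdot}=1\ \forall b\in A\}$. $\Gamma_2(A)$ is the subgroup of $(A,\cdot)$ generated by all $a*b$ and $[a,b]^{\cdot}$ (an ideal). Cohomology (trivial action): for a skew brace $K$ and an abelian group $A$ (written multiplicatively), a $2$-cocycle is a pair of maps $\alpha,\mu:K\times K\to A$ such that for all $x,y,z\in K$: $\alpha(1,y)=\alpha(x,1)=1$; $\mu(1,y)=\mu(x,1)=1$; $\alpha(y,z)\alpha(x\cdot y,z)^{-1}\alpha(x,y\cdot z)\alpha(x,y)^{-1}=1$; $\mu(y,z)\mu(x\circ y,z)^{-1}\mu(x,y\circ z)\mu(x,y)^{-1}=1$; $\alpha(y,z)\alpha(x\circ y,\lambda_x(z))^{-1}\alpha(x,\lambda_x(z))=\mu(x,y)\mu(x,y\cdot z)^{-1}\mu(x,z)$. It is a $2$-coboundary if there is $h:K\to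 A$ with $h(1)=1$, $\alpha(x,y)=h(x)h(y)h(x\cdot y)^{-1}$ and $\mu(x,y)=h(x)h(y)h(x\circ y)^{-1}$ for all $x,y$. $\mathrm{H}^2_b(K,A)$ is the group of $2$-cocycles (pointwise product) modulo $2$-coboundaries. $G=A\times_{(\alpha,\mu)}K$ is the skew brace on $A\times K$ with $(a_1,k_1)\cdot(a_2,k_2)=(a_1a_2\alpha(k_1,k_2),k_1\cdot k_2)$ and $(a_1,k_1)\circ(a_2,k_2)=(a_1a_2\mu(k_1,k_2),k_1\circ k_2)$. $A$ is identified with the ideal $A\times\{1\}\subseteq\mathrm{Ann}(G)$, and similarly for $B$ and $H$. Since $A\subseteq\mathrm{Ann}(G)$, the maps $\phi^G_{\cdot},\phi^G_*:(G/A)^2\to\Gamma_2(G)$, $\phi^G_{\cdot}(Ag_1,Ag_2)=[g_1,g_2]^{\cdot}$, $\phi^G_*(Ag_1,Ag_2)=g_1*g_2$, are well defined; similarly for $H$ with $B$. $\hat A=\mathrm{Hom}(A,\mathbb{C}^\times)$, and $\varepsilon_G:\hat A\to\mathrm{H}^2_b(K,\mathbb{C}^\times)$ is $\varepsilon_G(\lambda)=[(\lambda\circ\alpha,\lambda\circ\mu)]$ (composition of maps); $\varepsilon_H$ is defined likewise from $(\beta,\nu)$. *)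

theory Defs
  imports Complex_Main "HOL-Algebra.Coset" "HOL-Algebra.Generated_Groups"
begin

section \<open>Skew braces\<close>

text \<open>The two identities of a skew brace coincide, so the record has a single
  field \<open>one\<close>, shared by both group structures.\<close>

record 'a sbrace = "'a monoid" +
  circ :: "['a, 'a] \<Rightarrow> 'a" (infixl "\<circledcirc>\<index>" 70)

definition circ_group :: "('a, 'm) sbrace_scheme \<Rightarrow> 'a monoid" where
  "circ_group G = \<lparr>carrier = carrier G, mult = circ G, one = one G\<rparr>"

locale skew_brace = group A for A (structure) +
  assumes group_circ: "group (circ_group A)"
    and brace_distrib:
      "\<lbrakk>a \<in> carrier A; b \<in> carrier A; c \<in> carrier A\<rbrakk>
        \<Longrightarrow> a \<circledcirc> (b \<otimes> c) = (a \<circledcirc> b) \<otimes> inv a \<otimes> (a \<circledcirc> c)"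

definition lam :: "('a, 'm) sbrace_scheme \<Rightarrow> 'a \<Rightarrow> 'a \<Rightarrow> 'a" where
  "lam G a b = inv\<^bsub>G\<^esub> a \<otimes>\<^bsub>G\<^esub> (a \<circledcirc>\<^bsub>G\<^esub> b)"

definition star :: "('a, 'm) sbrace_scheme \<Rightarrow> 'a \<Rightarrow> 'a \<Rightarrow> 'a" where
  "star G a b = lam G a b \<otimes>\<^bsub>G\<^esub> inv\<^bsub>G\<^esub> b"

definition commutator :: "('a, 'm) monoid_scheme \<Rightarrow> 'a \<Rightarrow> 'a \<Rightarrow> 'a" where
  "commutator G a b = a \<otimes>\<^bsub>G\<^esub> b \<otimes>\<^bsub>G\<^esub> inv\<^bsub>G\<^esub> a \<otimes>\<^bsub>G\<^esub> inv\<^bsub>G\<^esub> b"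

definition brace_iso :: "('a, 'm) sbrace_scheme \<Rightarrow> ('b, 'n) sbrace_scheme \<Rightarrow> ('a \<Rightarrow> 'b) set" where
  "brace_iso G H =
    {f \<in> hom G H \<inter> hom (circ_group G) (circ_group H). bij_betw f (carrier G) (carrier H)}"

definition brace_ideal :: "'a set \<Rightarrow> ('a, 'm) sbrace_scheme \<Rightarrow> bool" where
  "brace_ideal I G \<longleftrightarrow> I \<lhd> G \<and> I \<lhd> circ_group G \<and>
    (\<forall>a\<in>carrier G. \<forall>x\<in>I. lam G a x \<in> I)"

definition Ann :: "('a, 'm) sbrace_scheme \<Rightarrow> 'a set" where
  "Ann G = {a \<in> carrier G. \<forall>b\<in>carrier G.
    star G a b = \<one>\<^bsub>G\<^esub> \<and> star G b a = \<one>\<^bsub>G\<^esub> \<and> commutator G a b = \<one>\<^bsub>G\<^esub>}"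

definition Gamma2_set :: "('a, 'm) sbrace_scheme \<Rightarrow> 'a set" where
  "Gamma2_set G = generate G
    {x. \<exists>a\<in>carrier G. \<exists>b\<in>carrier G. x = star G a b \<or> x = commutator G a b}"

definition Gamma2 :: "'a sbrace \<Rightarrow> 'a sbrace" where
  "Gamma2 G = G\<lparr>carrier := Gamma2_set G\<rparr>"

text \<open>For an ideal \<open>I\<close> the cosets of \<open>I\<close> in the two groups are the same sets, so the
  elementwise circle product of two cosets is again a coset.\<close>

definition quot_brace :: "'a sbrace \<Rightarrow> 'a set \<Rightarrow> 'a set sbrace" where
  "quot_brace G I = \<lparr>carrier = carrier (G Mod I), mult = mult (G Mod I), one = one (G Mod I),
    circ = mult (circ_group G Mod I)\<rparr>"

text \<open>The maps \<open>\<phi>\<close> on pairs of cosets. The description is meaningful when the value does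
  not depend on the representatives, in particular for cosets of
  a subgroup \<open>I \<subseteq> Ann G\<close>: see \<open>phi_comm_rep\<close> and \<open>phi_star_rep\<close> below.\<close>

definition phi_comm :: "'a sbrace \<Rightarrow> 'a set \<times> 'a set \<Rightarrow> 'a" where
  "phi_comm G = (\<lambda>(X, Y). THE z. \<forall>g1\<in>X. \<forall>g2\<in>Y. z = commutator G g1 g2)"

definition phi_star :: "'a sbrace \<Rightarrow> 'a set \<times> 'a set \<Rightarrow> 'a" where
  "phi_star G = (\<lambda>(X, Y). THE z. \<forall>g1\<in>X. \<forall>g2\<in>Y. z = star G g1 g2)"


section \<open>Second cohomology with trivial action\<close>

text \<open>Maps \<open>K \<times> K \<rightarrow> A\<close> are represented by extensional functions, so that each map
  on the carrier has exactly one representative.\<close>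

definition cocycle ::
  "'k sbrace \<Rightarrow> 'a monoid \<Rightarrow> ('k \<times> 'k \<Rightarrow> 'a) \<Rightarrow> ('k \<times> 'k \<Rightarrow> 'a) \<Rightarrow> bool" where
  "cocycle K A \<alpha> \<mu> \<longleftrightarrow>
    \<alpha> \<in> carrier K \<times> carrier K \<rightarrow>\<^sub>E carrier A \<and>
    \<mu> \<in> carrier K \<times> carrier K \<rightarrow>\<^sub>E carrier A \<and>
    (\<forall>x\<in>carrier K. \<alpha> (\<one>\<^bsub>K\<^esub>, x) = \<one>\<^bsub>A\<^esub> \<and> \<alpha> (x, \<one>\<^bsub>K\<^esub>) = \<one>\<^bsub>A\<^esub> \<and>
      \<mu> (\<one>\<^bsub>K\<^esub>, x) = \<one>\<^bsub>A\<^esub> \<and> \<mu> (x, \<one>\<^bsub>K\<^esub>) = \<one>\<^bsub>A\<^esub>) \<and>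
    (\<forall>x\<in>carrier K. \<forall>y\<in>carrier K. \<forall>z\<in>carrier K.
      \<alpha> (y, z) \<otimes>\<^bsub>A\<^esub> inv\<^bsub>A\<^esub> \<alpha> (x \<otimes>\<^bsub>K\<^esub> y, z) \<otimes>\<^bsub>A\<^esub> \<alpha> (x, y \<otimes>\<^bsub>K\<^esub> z) \<otimes>\<^bsub>A\<^esub> inv\<^bsub>A\<^esub> \<alpha> (x, y) = \<one>\<^bsub>A\<^esub> \<and>
      \<mu> (y, z) \<otimes>\<^bsub>A\<^esub> inv\<^bsub>A\<^esub> \<mu> (x \<circledcirc>\<^bsub>K\<^esub> y, z) \<otimes>\<^bsub>A\<^esub> \<mu> (x, y \<circledcirc>\<^bsub>K\<^esub> z) \<otimes>\<^bsub>A\<^esub> inv\<^bsub>A\<^esub> \<mu> (x, y) = \<one>\<^bsub>A\<^esub> \<and>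
      \<alpha> (y, z) \<otimes>\<^bsub>A\<^esub> inv\<^bsub>A\<^esub> \<alpha> (x \<circledcirc>\<^bsub>K\<^esub> y, lam K x z) \<otimes>\<^bsub>A\<^esub> \<alpha> (x, lam K x z) =
        \<mu> (x, y) \<otimes>\<^bsub>A\<^esub> inv\<^bsub>A\<^esub> \<mu> (x, y \<otimes>\<^bsub>K\<^esub> z) \<otimes>\<^bsub>A\<^esub> \<mu> (x, z))"

definition Z2b :: "'k sbrace \<Rightarrow> 'a monoid \<Rightarrow> (('k \<times> 'k \<Rightarrow> 'a) \<times> ('k \<times> 'k \<Rightarrow> 'a)) monoid" where
  "Z2b K A = \<lparr>carrier = {(\<alpha>, \<mu>). cocycle K A \<alpha> \<mu>},
    mult = (\<lambda>(\<alpha>, \<mu>) (\<alpha>', \<mu>').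
      (\<lambda>p\<in>carrier K \<times> carrier K. \<alpha> p \<otimes>\<^bsub>A\<^esub> \<alpha>' p, \<lambda>p\<in>carrier K \<times> carrier K. \<mu> p \<otimes>\<^bsub>A\<^esub> \<mu>' p)),
    one = (\<lambda>p\<in>carrier K \<times> carrier K. \<one>\<^bsub>A\<^esub>, \<lambda>p\<in>carrier K \<times> carrier K. \<one>\<^bsub>A\<^esub>)\<rparr>"

definition B2b :: "'k sbrace \<Rightarrow> 'a monoid \<Rightarrow> (('k \<times> 'k \<Rightarrow> 'a) \<times> ('k \<times> 'k \<Rightarrow> 'a)) set" where
  "B2b K A = {(\<alpha>, \<mu>) \<in> carrier (Z2b K A).
    \<exists>h \<in> carrier K \<rightarrow> carrier A. h \<one>\<^bsub>K\<^esub> = \<one>\<^bsub>A\<^esub> \<and>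
      (\<forall>x\<in>carrier K. \<forall>y\<in>carrier K.
        \<alpha> (x, y) = h x \<otimes>\<^bsub>A\<^esub> h y \<otimes>\<^bsub>A\<^esub> inv\<^bsub>A\<^esub> h (x \<otimes>\<^bsub>K\<^esub> y) \<and>
        \<mu> (x, y) = h x \<otimes>\<^bsub>A\<^esub> h y \<otimes>\<^bsub>A\<^esub> inv\<^bsub>A\<^esub> h (x \<circledcirc>\<^bsub>K\<^esub> y))}"

definition H2b :: "'k sbrace \<Rightarrow> 'a monoid \<Rightarrow> (('k \<times> 'k \<Rightarrow> 'a) \<times> ('k \<times> 'k \<Rightarrow> 'a)) set monoid" where
  "H2b K A = Z2b K A Mod B2b K A"

definition H2b_class ::
  "'k sbrace \<Rightarrow> 'a monoid \<Rightarrow> ('k \<times> 'k \<Rightarrow> 'a) \<times> ('k \<times> 'k \<Rightarrow> 'a)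
    \<Rightarrow> (('k \<times> 'k \<Rightarrow> 'a) \<times> ('k \<times> 'k \<Rightarrow> 'a)) set" where
  "H2b_class K A c = B2b K A #>\<^bsub>Z2b K A\<^esub> c"


section \<open>Extensions and characters\<close>

definition brace_ext ::
  "'a monoid \<Rightarrow> ('k \<times> 'k \<Rightarrow> 'a) \<times> ('k \<times> 'k \<Rightarrow> 'a) \<Rightarrow> 'k sbrace \<Rightarrow> ('a \<times> 'k) sbrace" where
  "brace_ext A = (\<lambda>(\<alpha>, \<mu>) K. \<lparr>carrier = carrier A \<times> carrier K,
    mult = (\<lambda>(a1, k1) (a2, k2). (a1 \<otimes>\<^bsub>A\<^esub> a2 \<otimes>\<^bsub>A\<^esub> \<alpha> (k1, k2), k1 \<otimes>\<^bsub>K\<^esub> k2)),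
    one = (\<one>\<^bsub>A\<^esub>, \<one>\<^bsub>K\<^esub>),
    circ = (\<lambda>(a1, k1) (a2, k2). (a1 \<otimes>\<^bsub>A\<^esub> a2 \<otimes>\<^bsub>A\<^esub> \<mu> (k1, k2), k1 \<circledcirc>\<^bsub>K\<^esub> k2))\<rparr>)"

definition ext_kernel :: "'a monoid \<Rightarrow> 'k sbrace \<Rightarrow> ('a \<times> 'k) set" where
  "ext_kernel A K = carrier A \<times> {\<one>\<^bsub>K\<^esub>}"

definition Cstar :: "complex monoid" where
  "Cstar = \<lparr>carrier = UNIV - {0}, mult = (*), one = 1\<rparr>"

definition char_set :: "'a monoid \<Rightarrow> ('a \<Rightarrow> complex) set" where
  "char_set A = hom A Cstar"

definition eps ::
  "'k sbrace \<Rightarrow> ('k \<times> 'k \<Rightarrow> 'a) \<times> ('k \<times> 'k \<Rightarrow> 'a) \<Rightarrow> ('a \<Rightarrow> complex)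
    \<Rightarrow> (('k \<times> 'k \<Rightarrow> complex) \<times> ('k \<times> 'k \<Rightarrow> complex)) set" where
  "eps K = (\<lambda>(\<alpha>, \<mu>) \<chi>. H2b_class K Cstar
    (compose (carrier K \<times> carrier K) \<chi> \<alpha>, compose (carrier K \<times> carrier K) \<chi> \<mu>))"



section \<open>Well-definedness\<close>

lemma (in skew_brace) circ_simps [simp]:
  "a \<in> carrier A \<Longrightarrow> b \<in> carrier A \<Longrightarrow> a \<circledcirc> b \<in> carrier A"
  "a \<in> carrier A \<Longrightarrow> \<one> \<circledcirc> a = a"
  "a \<in> carrier A \<Longrightarrow> a \<circledcirc> \<one> = a"
proof -
  interpret C: group "circ_group A" by (rule group_circ)
  show "a \<in> carrier A \<Longrightarrow> b \<in> carrier A \<Longrightarrow> a \<circledcirc> b \<in> carrier A"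
    using C.m_closed[of a b] by (simp add: circ_group_def)
  show "a \<in> carrier A \<Longrightarrow> \<one> \<circledcirc> a = a" using C.l_one[of a] by (simp add: circ_group_def)
  show "a \<in> carrier A \<Longrightarrow> a \<circledcirc> \<one> = a" using C.r_one[of a] by (simp add: circ_group_def)
qed

lemma (in skew_brace) circ_assoc:
  assumes "a \<in> carrier A" "b \<in> carrier A" "c \<in> carrier A"
  shows "(a \<circledcirc> b) \<circledcirc> c = a \<circledcirc> (b \<circledcirc> c)"
proof -
  interpret C: group "circ_group A" by (rule group_circ)
  show ?thesis using C.m_assoc[of a b c] assms by (simp add: circ_group_def)
qed

lemma (in skew_brace) lam_closed [simp]:
  "a \<in> carrier A \<Longrightarrow> b \<in> carrier A \<Longrightarrow> lam A a b \<in> carrier A"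
  by (simp add: lam_def)

lemma (in skew_brace) circ_lam:
  "a \<in> carrier A \<Longrightarrow> b \<in> carrier A \<Longrightarrow> a \<otimes> lam A a b = a \<circledcirc> b"
  by (simp add: lam_def m_assoc [symmetric])

lemma (in skew_brace) Ann_central:
  assumes "i \<in> Ann A" "g \<in> carrier A"
  shows "i \<in> carrier A" "g \<otimes> i = i \<otimes> g" "i \<circledcirc> g = i \<otimes> g" "g \<circledcirc> i = i \<otimes> g"
proof -
  show i: "i \<in> carrier A" using assms by (simp add: Ann_def)
  have c: "commutator A i g = \<one>" and s: "star A i g = \<one>" "star A g i = \<one>"
    using assms by (auto simp: Ann_def)
  have "i \<otimes> g \<otimes> inv i = g"
    using c i assms(2) inv_equality[of "i \<otimes> g \<otimes> inv i" "inv g"]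
    by (simp add: commutator_def)
  then show gi: "g \<otimes> i = i \<otimes> g" by (metis assms(2) i inv_solve_right m_closed)
  have *: "x \<circledcirc> y = x \<otimes> y" if "star A x y = \<one>" "x \<in> carrier A" "y \<in> carrier A" for x y
  proof -
    have "lam A x y = y" using that inv_equality[of "lam A x y" "inv y"] by (simp add: star_def)
    then show ?thesis using circ_lam that by metis
  qed
  show "i \<circledcirc> g = i \<otimes> g" "g \<circledcirc> i = i \<otimes> g" using * s i assms(2) gi by auto
qed

lemma (in skew_brace) rep_indep:
  assumes "i \<in> Ann A" "j \<in> Ann A" and a: "a \<in> carrier A" and b: "b \<in> carrier A"
  shows "commutator A (i \<otimes> a) (j \<otimes> b) = commutator A a b"
    and "star A (i \<otimes> a) (j \<otimes> b) = star A a b"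
proof -
  note I = Ann_central[OF assms(1)] and J = Ann_central[OF assms(2)]
  have i: "i \<in> carrier A" and j: "j \<in> carrier A" using I(1) J(1) a by auto
  have ii: "inv i \<otimes> x = x \<otimes> inv i" and jj: "inv j \<otimes> x = x \<otimes> inv j" if "x \<in> carrier A" for x
    using Ann_central(2)[OF assms(1) that] Ann_central(2)[OF assms(2) that] that i j
    by (metis inv_closed inv_solve_left inv_solve_right m_assoc m_closed)+
  have I': "x \<otimes> i = i \<otimes> x" if "x \<in> carrier A" for x
    using Ann_central(2)[OF assms(1) that] .
  have sw: "x \<otimes> (c \<otimes> y) = c \<otimes> (x \<otimes> y)"
    if "x \<in> carrier A" "y \<in> carrier A" "c \<in> carrier A" "c \<otimes> x = x \<otimes> c" for x y c
    using that by (metis m_assoc)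
  have canc: "c \<otimes> (inv c \<otimes> y) = y" "inv c \<otimes> (c \<otimes> y) = y"
    if "c \<in> carrier A" "y \<in> carrier A" for c y
    using that by (simp_all add: m_assoc [symmetric])
  have iia: "i \<otimes> (x \<otimes> (inv i \<otimes> y)) = x \<otimes> y" "inv i \<otimes> (x \<otimes> (i \<otimes> y)) = x \<otimes> y"
    and jja: "j \<otimes> (x \<otimes> (inv j \<otimes> y)) = x \<otimes> y"
    if "x \<in> carrier A" "y \<in> carrier A" for x y
    using that i j sw[OF that _ ii] sw[OF that _ I'[symmetric]] sw[OF that _ jj]
    by (simp_all add: canc)
  have inva: "inv (i \<otimes> a) = inv i \<otimes> inv a" and invb: "inv (j \<otimes> b) = inv j \<otimes> inv b"
    using i j a b ii jj by (simp_all add: inv_mult_group)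
  have "commutator A (i \<otimes> a) (j \<otimes> b) = i \<otimes> ((a \<otimes> (j \<otimes> b)) \<otimes> (inv i \<otimes> (inv a \<otimes> (inv j \<otimes> inv b))))"
    unfolding commutator_def inva invb using i j a b by (simp add: m_assoc)
  also have "\<dots> = a \<otimes> (j \<otimes> ((b \<otimes> inv a) \<otimes> (inv j \<otimes> inv b)))"
    using i j a b by (subst iia(1)) (simp_all add: m_assoc)
  also have "\<dots> = commutator A a b"
    using i j a b by (subst jja) (simp_all add: commutator_def m_assoc)
  finally show "commutator A (i \<otimes> a) (j \<otimes> b) = commutator A a b" .
  have "(i \<otimes> a) \<circledcirc> (j \<otimes> b) = (i \<circledcirc> a) \<circledcirc> (b \<circledcirc> j)" using I J a b by simp
  also have "\<dots> = i \<circledcirc> ((a \<circledcirc> b) \<circledcirc> j)" using i j a b by (simp add: circ_assoc)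
  also have "\<dots> = i \<otimes> (j \<otimes> (a \<circledcirc> b))" using I(3) J(4) i j a b by simp
  finally have *: "(i \<otimes> a) \<circledcirc> (j \<otimes> b) = i \<otimes> (j \<otimes> (a \<circledcirc> b))" .
  have "star A (i \<otimes> a) (j \<otimes> b) =
      inv i \<otimes> (inv a \<otimes> (i \<otimes> ((j \<otimes> (a \<circledcirc> b)) \<otimes> (inv j \<otimes> inv b))))"
    unfolding star_def lam_def inva invb * using i j a b by (simp add: m_assoc)
  also have "\<dots> = inv a \<otimes> (j \<otimes> ((a \<circledcirc> b) \<otimes> (inv j \<otimes> inv b)))"
    using i j a b by (subst iia(2)) (simp_all add: m_assoc)
  also have "\<dots> = star A a b"
    using i j a b by (subst jja) (simp_all add: star_def lam_def m_assoc)
  finally show "star A (i \<otimes> a) (j \<otimes> b) = star A a b" .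
qed

lemma phi_rep:
  assumes "skew_brace G" "subgroup I G" "I \<subseteq> Ann G" "g1 \<in> carrier G" "g2 \<in> carrier G"
  shows phi_comm_rep: "phi_comm G (I #>\<^bsub>G\<^esub> g1, I #>\<^bsub>G\<^esub> g2) = commutator G g1 g2"
    and phi_star_rep: "phi_star G (I #>\<^bsub>G\<^esub> g1, I #>\<^bsub>G\<^esub> g2) = star G g1 g2"
proof -
  interpret skew_brace G by fact
  have *: "g1 \<in> I #>\<^bsub>G\<^esub> g1" "g2 \<in> I #>\<^bsub>G\<^esub> g2"
    using rcos_self[OF assms(4,2)] rcos_self[OF assms(5,2)] by auto
  have c: "commutator G x y = commutator G g1 g2" and s: "star G x y = star G g1 g2"
    if "x \<in> I #>\<^bsub>G\<^esub> g1" "y \<in> I #>\<^bsub>G\<^esub> g2" for x y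
  proof -
    obtain i j where "x = i \<otimes>\<^bsub>G\<^esub> g1" "i \<in> I" "y = j \<otimes>\<^bsub>G\<^esub> g2" "j \<in> I"
      using \<open>x \<in> _\<close> \<open>y \<in> _\<close> unfolding r_coset_def by blast
    then show "commutator G x y = commutator G g1 g2" "star G x y = star G g1 g2"
      using rep_indep[OF _ _ assms(4,5), of i j] assms(3) by (simp_all add: subset_iff)
  qed
  show "phi_comm G (I #>\<^bsub>G\<^esub> g1, I #>\<^bsub>G\<^esub> g2) = commutator G g1 g2"
    unfolding phi_comm_def prod.case
  proof (rule the_equality)
    show "\<forall>x\<in>I #>\<^bsub>G\<^esub> g1. \<forall>y\<in>I #>\<^bsub>G\<^esub> g2. commutator G g1 g2 = commutator G x y"
      by (intro ballI, rule c[symmetric])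
    fix z assume "\<forall>x\<in>I #>\<^bsub>G\<^esub> g1. \<forall>y\<in>I #>\<^bsub>G\<^esub> g2. z = commutator G x y"
    from bspec[OF bspec[OF this *(1)] *(2)] show "z = commutator G g1 g2" .
  qed
  show "phi_star G (I #>\<^bsub>G\<^esub> g1, I #>\<^bsub>G\<^esub> g2) = star G g1 g2"
    unfolding phi_star_def prod.case
  proof (rule the_equality)
    show "\<forall>x\<in>I #>\<^bsub>G\<^esub> g1. \<forall>y\<in>I #>\<^bsub>G\<^esub> g2. star G g1 g2 = star G x y"
      by (intro ballI, rule s[symmetric])
    fix z assume "\<forall>x\<in>I #>\<^bsub>G\<^esub> g1. \<forall>y\<in>I #>\<^bsub>G\<^esub> g2. z = star G x y"
    from bspec[OF bspec[OF this *(1)] *(2)] show "z = star G g1 g2" .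
  qed
qed

context
  fixes K :: "'k sbrace" and A :: "'a monoid" and \<alpha> \<mu> :: "'k \<times> 'k \<Rightarrow> 'a"
  assumes K: "skew_brace K" and A: "comm_group A" and c: "cocycle K A \<alpha> \<mu>"
begin

interpretation K: skew_brace K by (rule K)
interpretation A: comm_group A by (rule A)

lemma cocycle_closed [simp]:
  assumes "x \<in> carrier K" "y \<in> carrier K"
  shows "\<alpha> (x, y) \<in> carrier A" "\<mu> (x, y) \<in> carrier A"
  using c assms by (auto simp: cocycle_def)

lemma cocycle_one [simp]:
  assumes "x \<in> carrier K"
  shows "\<alpha> (\<one>\<^bsub>K\<^esub>, x) = \<one>\<^bsub>A\<^esub>" "\<alpha> (x, \<one>\<^bsub>K\<^esub>) = \<one>\<^bsub>A\<^esub>" "\<mu> (\<one>\<^bsub>K\<^esub>, x) = \<one>\<^bsub>A\<^esub>" "\<mu> (x, \<one>\<^bsub>K\<^esub>) = \<one>\<^bsub>A\<^esub>"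
  using c assms by (auto simp: cocycle_def)

lemma comm_cancel:
  assumes "p \<in> carrier A" "q \<in> carrier A" "r \<in> carrier A" "s \<in> carrier A"
  shows "p \<otimes>\<^bsub>A\<^esub> inv\<^bsub>A\<^esub> q \<otimes>\<^bsub>A\<^esub> r \<otimes>\<^bsub>A\<^esub> inv\<^bsub>A\<^esub> s = \<one>\<^bsub>A\<^esub> \<longleftrightarrow> p \<otimes>\<^bsub>A\<^esub> r = s \<otimes>\<^bsub>A\<^esub> q"
proof -
  have "p \<otimes>\<^bsub>A\<^esub> inv\<^bsub>A\<^esub> q \<otimes>\<^bsub>A\<^esub> r \<otimes>\<^bsub>A\<^esub> inv\<^bsub>A\<^esub> s = (p \<otimes>\<^bsub>A\<^esub> r) \<otimes>\<^bsub>A\<^esub> inv\<^bsub>A\<^esub> (s \<otimes>\<^bsub>A\<^esub> q)"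
    using assms by (simp add: A.inv_mult A.m_ac)
  also have "\<dots> = \<one>\<^bsub>A\<^esub> \<longleftrightarrow> p \<otimes>\<^bsub>A\<^esub> r = s \<otimes>\<^bsub>A\<^esub> q"
    using assms A.inv_solve_right[of "\<one>\<^bsub>A\<^esub>" "p \<otimes>\<^bsub>A\<^esub> r" "s \<otimes>\<^bsub>A\<^esub> q"] by auto
  finally show ?thesis .
qed

lemma cocycle_mult:
  assumes "x \<in> carrier K" "y \<in> carrier K" "z \<in> carrier K"
  shows "\<alpha> (y, z) \<otimes>\<^bsub>A\<^esub> \<alpha> (x, y \<otimes>\<^bsub>K\<^esub> z) = \<alpha> (x, y) \<otimes>\<^bsub>A\<^esub> \<alpha> (x \<otimes>\<^bsub>K\<^esub> y, z)"
    and "\<mu> (y, z) \<otimes>\<^bsub>A\<^esub> \<mu> (x, y \<circledcirc>\<^bsub>K\<^esub> z) = \<mu> (x, y) \<otimes>\<^bsub>A\<^esub> \<mu> (x \<circledcirc>\<^bsub>K\<^esub> y, z)"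
  using c assms by (auto simp: cocycle_def comm_cancel)

lemma cocycle_mixed:
  assumes "x \<in> carrier K" "y \<in> carrier K" "z \<in> carrier K"
  shows "\<alpha> (y, z) \<otimes>\<^bsub>A\<^esub> \<mu> (x, y \<otimes>\<^bsub>K\<^esub> z) =
    \<mu> (x, y) \<otimes>\<^bsub>A\<^esub> (\<mu> (x, z) \<otimes>\<^bsub>A\<^esub> inv\<^bsub>A\<^esub> \<alpha> (x, lam K x z)) \<otimes>\<^bsub>A\<^esub> \<alpha> (x \<circledcirc>\<^bsub>K\<^esub> y, lam K x z)"
proof -
  have *: "p \<otimes>\<^bsub>A\<^esub> v = u \<otimes>\<^bsub>A\<^esub> (w \<otimes>\<^bsub>A\<^esub> inv\<^bsub>A\<^esub> r) \<otimes>\<^bsub>A\<^esub> q"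
    if "p \<otimes>\<^bsub>A\<^esub> inv\<^bsub>A\<^esub> q \<otimes>\<^bsub>A\<^esub> r = u \<otimes>\<^bsub>A\<^esub> inv\<^bsub>A\<^esub> v \<otimes>\<^bsub>A\<^esub> w" "p \<in> carrier A" "q \<in> carrier A"
      "r \<in> carrier A" "u \<in> carrier A" "v \<in> carrier A" "w \<in> carrier A" for p q r u v w
  proof -
    have canc: "s \<otimes>\<^bsub>A\<^esub> (inv\<^bsub>A\<^esub> s \<otimes>\<^bsub>A\<^esub> x) = x" "inv\<^bsub>A\<^esub> s \<otimes>\<^bsub>A\<^esub> (s \<otimes>\<^bsub>A\<^esub> x) = x"
      if "s \<in> carrier A" "x \<in> carrier A" for s x
      using that by (simp_all add: A.m_assoc[symmetric])
    have "(p \<otimes>\<^bsub>A\<^esub> inv\<^bsub>A\<^esub> q \<otimes>\<^bsub>A\<^esub> r) \<otimes>\<^bsub>A\<^esub> (q \<otimes>\<^bsub>A\<^esub> inv\<^bsub>A\<^esub> r \<otimes>\<^bsub>A\<^esub> v)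
        = p \<otimes>\<^bsub>A\<^esub> (inv\<^bsub>A\<^esub> q \<otimes>\<^bsub>A\<^esub> (q \<otimes>\<^bsub>A\<^esub> (r \<otimes>\<^bsub>A\<^esub> (inv\<^bsub>A\<^esub> r \<otimes>\<^bsub>A\<^esub> v))))"
      using that(2-) by (simp add: A.m_ac)
    then have "p \<otimes>\<^bsub>A\<^esub> v = (p \<otimes>\<^bsub>A\<^esub> inv\<^bsub>A\<^esub> q \<otimes>\<^bsub>A\<^esub> r) \<otimes>\<^bsub>A\<^esub> (q \<otimes>\<^bsub>A\<^esub> inv\<^bsub>A\<^esub> r \<otimes>\<^bsub>A\<^esub> v)"
      using that(2-) by (simp add: canc)
    also have "\<dots> = u \<otimes>\<^bsub>A\<^esub> (w \<otimes>\<^bsub>A\<^esub> inv\<^bsub>A\<^esub> r) \<otimes>\<^bsub>A\<^esub> q"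
    proof -
      have "u \<otimes>\<^bsub>A\<^esub> inv\<^bsub>A\<^esub> v \<otimes>\<^bsub>A\<^esub> w \<otimes>\<^bsub>A\<^esub> (q \<otimes>\<^bsub>A\<^esub> inv\<^bsub>A\<^esub> r \<otimes>\<^bsub>A\<^esub> v)
          = inv\<^bsub>A\<^esub> v \<otimes>\<^bsub>A\<^esub> (v \<otimes>\<^bsub>A\<^esub> (u \<otimes>\<^bsub>A\<^esub> (w \<otimes>\<^bsub>A\<^esub> inv\<^bsub>A\<^esub> r) \<otimes>\<^bsub>A\<^esub> q))"
        using that(2-) by (simp add: A.m_ac)
      then show ?thesis unfolding that(1) using that(2-) by (simp add: canc)
    qed
    finally show ?thesis .
  qed
  show ?thesis by (rule *) (use c assms in \<open>auto simp: cocycle_def\<close>)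
qed

lemma skew_brace_ext: "skew_brace (brace_ext A (\<alpha>, \<mu>) K)" (is "skew_brace ?G")
proof -
  note defs = brace_ext_def circ_group_def
  interpret C: group "circ_group K" by (rule K.group_circ)
  have Cinv: "\<exists>y\<in>carrier K. y \<circledcirc>\<^bsub>K\<^esub> x = \<one>\<^bsub>K\<^esub>" if "x \<in> carrier K" for x
    using C.l_inv_ex[of x] that by (simp add: circ_group_def)
  have assoc: "a \<otimes>\<^bsub>A\<^esub> b \<otimes>\<^bsub>A\<^esub> p \<otimes>\<^bsub>A\<^esub> d \<otimes>\<^bsub>A\<^esub> q = a \<otimes>\<^bsub>A\<^esub> (b \<otimes>\<^bsub>A\<^esub> d \<otimes>\<^bsub>A\<^esub> r) \<otimes>\<^bsub>A\<^esub> s"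
    if "r \<otimes>\<^bsub>A\<^esub> s = p \<otimes>\<^bsub>A\<^esub> q" "a \<in> carrier A" "b \<in> carrier A" "d \<in> carrier A" "p \<in> carrier A"
      "q \<in> carrier A" "r \<in> carrier A" "s \<in> carrier A" for a b d p q r s
  proof -
    have "a \<otimes>\<^bsub>A\<^esub> b \<otimes>\<^bsub>A\<^esub> p \<otimes>\<^bsub>A\<^esub> d \<otimes>\<^bsub>A\<^esub> q = a \<otimes>\<^bsub>A\<^esub> b \<otimes>\<^bsub>A\<^esub> d \<otimes>\<^bsub>A\<^esub> (p \<otimes>\<^bsub>A\<^esub> q)"
      using that(2-) by (simp add: A.m_ac)
    also have "\<dots> = a \<otimes>\<^bsub>A\<^esub> (b \<otimes>\<^bsub>A\<^esub> d \<otimes>\<^bsub>A\<^esub> r) \<otimes>\<^bsub>A\<^esub> s"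
      unfolding that(1)[symmetric] using that(2-) by (simp add: A.m_ac)
    finally show ?thesis .
  qed
  have linv: "(inv\<^bsub>A\<^esub> a \<otimes>\<^bsub>A\<^esub> inv\<^bsub>A\<^esub> p) \<otimes>\<^bsub>A\<^esub> a \<otimes>\<^bsub>A\<^esub> p = \<one>\<^bsub>A\<^esub>" if "a \<in> carrier A" "p \<in> carrier A" for a p
    using that by (simp add: A.inv_mult[symmetric] A.m_assoc)
  have G: "group ?G"
  proof (rule groupI, goal_cases)
    case (5 x)
    then obtain a k where x: "x = (a, k)" "a \<in> carrier A" "k \<in> carrier K" by (auto simp: defs)
    then show ?case
      by (intro bexI[of _ "(inv\<^bsub>A\<^esub> a \<otimes>\<^bsub>A\<^esub> inv\<^bsub>A\<^esub> \<alpha> (inv\<^bsub>K\<^esub> k, k), inv\<^bsub>K\<^esub> k)"])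
        (auto simp: defs linv)
  qed (auto simp: defs K.m_assoc intro!: assoc cocycle_mult)
  interpret G: group ?G by (rule G)
  have C: "group (circ_group ?G)"
  proof (rule groupI, goal_cases)
    case (5 x)
    then obtain a k where x: "x = (a, k)" "a \<in> carrier A" "k \<in> carrier K" by (auto simp: defs)
    then obtain l where "l \<in> carrier K" "l \<circledcirc>\<^bsub>K\<^esub> k = \<one>\<^bsub>K\<^esub>" using Cinv by blast
    with x show ?case
      by (intro bexI[of _ "(inv\<^bsub>A\<^esub> a \<otimes>\<^bsub>A\<^esub> inv\<^bsub>A\<^esub> \<mu> (l, k), l)"]) (auto simp: defs linv)
  qed (auto simp: defs K.circ_assoc intro!: assoc cocycle_mult)
  show ?thesis
  proof (intro skew_brace.intro skew_brace_axioms.intro G C)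
    fix u v w assume "u \<in> carrier ?G" "v \<in> carrier ?G" "w \<in> carrier ?G"
    then obtain a x b y d z where uvw: "u = (a, x)" "v = (b, y)" "w = (d, z)"
      and ab: "a \<in> carrier A" "b \<in> carrier A" "d \<in> carrier A"
      and xyz: "x \<in> carrier K" "y \<in> carrier K" "z \<in> carrier K" by (auto simp: defs)
    define e where "e = \<mu> (x, z) \<otimes>\<^bsub>A\<^esub> inv\<^bsub>A\<^esub> \<alpha> (x, lam K x z)"
    have e: "e \<in> carrier A" using xyz by (simp add: e_def)
    define t where "t = (d \<otimes>\<^bsub>A\<^esub> e, lam K x z)"
    have t: "t \<in> carrier ?G" using ab xyz e by (simp add: t_def defs)
    have u: "u \<in> carrier ?G" "v \<in> carrier ?G" "w \<in> carrier ?G" by fact+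
    have cl: "u \<circledcirc>\<^bsub>?G\<^esub> v \<in> carrier ?G" "u \<circledcirc>\<^bsub>?G\<^esub> w \<in> carrier ?G"
      using ab xyz by (simp_all add: uvw defs)
    have "u \<otimes>\<^bsub>?G\<^esub> t = u \<circledcirc>\<^bsub>?G\<^esub> w"
      using ab xyz by (simp add: uvw t_def defs K.circ_lam e_def A.m_assoc)
    then have teq: "t = inv\<^bsub>?G\<^esub> u \<otimes>\<^bsub>?G\<^esub> (u \<circledcirc>\<^bsub>?G\<^esub> w)"
      using u t G.inv_solve_left[of t u "u \<circledcirc>\<^bsub>?G\<^esub> w"] cl by simp
    have yz: "x \<circledcirc>\<^bsub>K\<^esub> (y \<otimes>\<^bsub>K\<^esub> z) = (x \<circledcirc>\<^bsub>K\<^esub> y) \<otimes>\<^bsub>K\<^esub> lam K x z"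
      using xyz by (simp add: K.brace_distrib lam_def K.m_assoc)
    have "u \<circledcirc>\<^bsub>?G\<^esub> (v \<otimes>\<^bsub>?G\<^esub> w) =
      (a \<otimes>\<^bsub>A\<^esub> b \<otimes>\<^bsub>A\<^esub> d \<otimes>\<^bsub>A\<^esub> (\<alpha> (y, z) \<otimes>\<^bsub>A\<^esub> \<mu> (x, y \<otimes>\<^bsub>K\<^esub> z)), (x \<circledcirc>\<^bsub>K\<^esub> y) \<otimes>\<^bsub>K\<^esub> lam K x z)"
      using ab xyz by (simp add: uvw defs yz A.m_ac)
    also have "\<dots> = (u \<circledcirc>\<^bsub>?G\<^esub> v) \<otimes>\<^bsub>?G\<^esub> t"
      unfolding cocycle_mixed[OF xyz, folded e_def]
      using ab xyz e by (simp add: uvw t_def defs A.m_ac)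
    also have "\<dots> = (u \<circledcirc>\<^bsub>?G\<^esub> v) \<otimes>\<^bsub>?G\<^esub> inv\<^bsub>?G\<^esub> u \<otimes>\<^bsub>?G\<^esub> (u \<circledcirc>\<^bsub>?G\<^esub> w)"
      unfolding teq using u cl by (simp add: G.m_assoc)
    finally show "u \<circledcirc>\<^bsub>?G\<^esub> (v \<otimes>\<^bsub>?G\<^esub> w) = (u \<circledcirc>\<^bsub>?G\<^esub> v) \<otimes>\<^bsub>?G\<^esub> inv\<^bsub>?G\<^esub> u \<otimes>\<^bsub>?G\<^esub> (u \<circledcirc>\<^bsub>?G\<^esub> w)" .
  qed
qed

lemma ext_kernel_Ann: "ext_kernel A K \<subseteq> Ann (brace_ext A (\<alpha>, \<mu>) K)" (is "_ \<subseteq> Ann ?G")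
proof
  fix i assume "i \<in> ext_kernel A K"
  then obtain a where i: "i = (a, \<one>\<^bsub>K\<^esub>)" "a \<in> carrier A" by (auto simp: ext_kernel_def)
  interpret G: skew_brace ?G by (rule skew_brace_ext)
  have ic: "i \<in> carrier ?G" using i by (simp add: brace_ext_def)
  have "star ?G i g = \<one>\<^bsub>?G\<^esub> \<and> star ?G g i = \<one>\<^bsub>?G\<^esub> \<and> commutator ?G i g = \<one>\<^bsub>?G\<^esub>"
    if g: "g \<in> carrier ?G" for g
  proof -
    have comm: "i \<otimes>\<^bsub>?G\<^esub> g = g \<otimes>\<^bsub>?G\<^esub> i"
      and circ: "i \<circledcirc>\<^bsub>?G\<^esub> g = i \<otimes>\<^bsub>?G\<^esub> g" "g \<circledcirc>\<^bsub>?G\<^esub> i = g \<otimes>\<^bsub>?G\<^esub> i"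
      using g i by (auto simp: brace_ext_def A.m_comm)
    have canc: "inv\<^bsub>?G\<^esub> x \<otimes>\<^bsub>?G\<^esub> (x \<otimes>\<^bsub>?G\<^esub> y) \<otimes>\<^bsub>?G\<^esub> inv\<^bsub>?G\<^esub> y = \<one>\<^bsub>?G\<^esub>"
      if "x \<in> carrier ?G" "y \<in> carrier ?G" for x y
      using that by (simp add: G.m_assoc)
    have "commutator ?G i g = (i \<otimes>\<^bsub>?G\<^esub> g) \<otimes>\<^bsub>?G\<^esub> inv\<^bsub>?G\<^esub> (g \<otimes>\<^bsub>?G\<^esub> i)"
      using g ic by (simp add: commutator_def G.m_assoc G.inv_mult_group)
    then have "commutator ?G i g = \<one>\<^bsub>?G\<^esub>"
      unfolding comm using g ic by simp
    then show ?thesis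
      unfolding star_def lam_def circ using canc g ic by blast
  qed
  then show "i \<in> Ann ?G" using ic by (simp add: Ann_def)
qed

lemma ext_kernel_ideal: "brace_ideal (ext_kernel A K) (brace_ext A (\<alpha>, \<mu>) K)"
  (is "brace_ideal ?I ?G")
proof -
  interpret G: skew_brace ?G by (rule skew_brace_ext)
  interpret C: group "circ_group ?G" by (rule G.group_circ)
  have sub: "subgroup ?I G'" if G': "group G'" "carrier G' = carrier A \<times> carrier K"
    "\<And>a b. a \<in> carrier A \<Longrightarrow> b \<in> carrier A \<Longrightarrow>
      (a, \<one>\<^bsub>K\<^esub>) \<otimes>\<^bsub>G'\<^esub> (b, \<one>\<^bsub>K\<^esub>) = (a \<otimes>\<^bsub>A\<^esub> b, \<one>\<^bsub>K\<^esub>)" "\<one>\<^bsub>G'\<^esub> = (\<one>\<^bsub>A\<^esub>, \<one>\<^bsub>K\<^esub>)" for G'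
  proof -
    interpret G': group G' by fact
    have "inv\<^bsub>G'\<^esub> (a, \<one>\<^bsub>K\<^esub>) = (inv\<^bsub>A\<^esub> a, \<one>\<^bsub>K\<^esub>)" if "a \<in> carrier A" for a
      by (rule G'.inv_equality) (simp_all add: G' that)
    then show ?thesis
      by (intro G'.subgroupI) (auto simp: ext_kernel_def G')
  qed
  have subG: "subgroup ?I ?G"
    using G.is_group by (rule sub) (simp_all add: brace_ext_def)
  have subC: "subgroup ?I (circ_group ?G)"
    using G.group_circ by (rule sub) (simp_all add: circ_group_def brace_ext_def)
  note cen = G.Ann_central[OF subsetD[OF ext_kernel_Ann]]
  have "?I \<lhd> ?G"
  proof (rule G.normal_invI[OF subG])
    fix x h assume x: "x \<in> carrier ?G" and h: "h \<in> ?I"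
    have "x \<otimes>\<^bsub>?G\<^esub> h \<otimes>\<^bsub>?G\<^esub> inv\<^bsub>?G\<^esub> x = h"
      using cen(1,2)[OF h x] x by (simp add: G.m_assoc)
    then show "x \<otimes>\<^bsub>?G\<^esub> h \<otimes>\<^bsub>?G\<^esub> inv\<^bsub>?G\<^esub> x \<in> ?I" using h by simp
  qed
  moreover have "?I \<lhd> circ_group ?G"
  proof (rule C.normal_invI[OF subC])
    fix x h assume x: "x \<in> carrier (circ_group ?G)" and h: "h \<in> ?I"
    have xc: "x \<in> carrier ?G" using x by (simp add: circ_group_def)
    have "x \<otimes>\<^bsub>circ_group ?G\<^esub> h = h \<otimes>\<^bsub>circ_group ?G\<^esub> x"
      using cen(3,4)[OF h xc] by (simp add: circ_group_def)
    then have "x \<otimes>\<^bsub>circ_group ?G\<^esub> h \<otimes>\<^bsub>circ_group ?G\<^esub> inv\<^bsub>circ_group ?G\<^esub> x = h"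
      using x subgroup.mem_carrier[OF subC h] by (simp add: C.m_assoc)
    then show "x \<otimes>\<^bsub>circ_group ?G\<^esub> h \<otimes>\<^bsub>circ_group ?G\<^esub> inv\<^bsub>circ_group ?G\<^esub> x \<in> ?I" using h by simp
  qed
  moreover have "lam ?G a x \<in> ?I" if "a \<in> carrier ?G" "x \<in> ?I" for a x
  proof -
    have "lam ?G a x = x"
      using cen[OF that(2,1)] that(1) by (metis G.inv_solve_left G.m_closed lam_def)
    then show ?thesis using that by simp
  qed
  ultimately show ?thesis by (simp add: brace_ideal_def)
qed

end

declare cocycle_closed [simp del] cocycle_one [simp del]

lemma cocycle_iff:
  assumes K: "skew_brace K" and A: "comm_group A"
  shows "cocycle K A \<alpha> \<mu> \<longleftrightarrow>
    \<alpha> \<in> carrier K \<times> carrier K \<rightarrow>\<^sub>E carrier A \<and>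
    \<mu> \<in> carrier K \<times> carrier K \<rightarrow>\<^sub>E carrier A \<and>
    (\<forall>x\<in>carrier K. \<alpha> (\<one>\<^bsub>K\<^esub>, x) = \<one>\<^bsub>A\<^esub> \<and> \<alpha> (x, \<one>\<^bsub>K\<^esub>) = \<one>\<^bsub>A\<^esub> \<and>
      \<mu> (\<one>\<^bsub>K\<^esub>, x) = \<one>\<^bsub>A\<^esub> \<and> \<mu> (x, \<one>\<^bsub>K\<^esub>) = \<one>\<^bsub>A\<^esub>) \<and>
    (\<forall>x\<in>carrier K. \<forall>y\<in>carrier K. \<forall>z\<in>carrier K.
      \<alpha> (y, z) \<otimes>\<^bsub>A\<^esub> \<alpha> (x, y \<otimes>\<^bsub>K\<^esub> z) = \<alpha> (x, y) \<otimes>\<^bsub>A\<^esub> \<alpha> (x \<otimes>\<^bsub>K\<^esub> y, z) \<and>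
      \<mu> (y, z) \<otimes>\<^bsub>A\<^esub> \<mu> (x, y \<circledcirc>\<^bsub>K\<^esub> z) = \<mu> (x, y) \<otimes>\<^bsub>A\<^esub> \<mu> (x \<circledcirc>\<^bsub>K\<^esub> y, z) \<and>
      \<alpha> (y, z) \<otimes>\<^bsub>A\<^esub> \<alpha> (x, lam K x z) \<otimes>\<^bsub>A\<^esub> \<mu> (x, y \<otimes>\<^bsub>K\<^esub> z) =
        \<mu> (x, y) \<otimes>\<^bsub>A\<^esub> \<mu> (x, z) \<otimes>\<^bsub>A\<^esub> \<alpha> (x \<circledcirc>\<^bsub>K\<^esub> y, lam K x z))"
proof -
  interpret K: skew_brace K by (rule K)
  interpret A: comm_group A by (rule A)
  have inv: "u = v \<longleftrightarrow> u \<otimes>\<^bsub>A\<^esub> inv\<^bsub>A\<^esub> v = \<one>\<^bsub>A\<^esub>" if "u \<in> carrier A" "v \<in> carrier A" for u v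
    using that A.inv_solve_right[of "\<one>\<^bsub>A\<^esub>" u v] by auto
  have e4: "p \<otimes>\<^bsub>A\<^esub> inv\<^bsub>A\<^esub> q \<otimes>\<^bsub>A\<^esub> r \<otimes>\<^bsub>A\<^esub> inv\<^bsub>A\<^esub> s = \<one>\<^bsub>A\<^esub> \<longleftrightarrow> p \<otimes>\<^bsub>A\<^esub> r = s \<otimes>\<^bsub>A\<^esub> q"
    if "p \<in> carrier A" "q \<in> carrier A" "r \<in> carrier A" "s \<in> carrier A" for p q r s
    using that inv[of "p \<otimes>\<^bsub>A\<^esub> r" "s \<otimes>\<^bsub>A\<^esub> q"] by (simp add: A.inv_mult A.m_ac)
  have e6: "p \<otimes>\<^bsub>A\<^esub> inv\<^bsub>A\<^esub> q \<otimes>\<^bsub>A\<^esub> r = u \<otimes>\<^bsub>A\<^esub> inv\<^bsub>A\<^esub> v \<otimes>\<^bsub>A\<^esub> w \<longleftrightarrow>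
      p \<otimes>\<^bsub>A\<^esub> r \<otimes>\<^bsub>A\<^esub> v = u \<otimes>\<^bsub>A\<^esub> w \<otimes>\<^bsub>A\<^esub> q"
    if "p \<in> carrier A" "q \<in> carrier A" "r \<in> carrier A" "u \<in> carrier A" "v \<in> carrier A"
      "w \<in> carrier A" for p q r u v w
    using that inv[of "p \<otimes>\<^bsub>A\<^esub> inv\<^bsub>A\<^esub> q \<otimes>\<^bsub>A\<^esub> r" "u \<otimes>\<^bsub>A\<^esub> inv\<^bsub>A\<^esub> v \<otimes>\<^bsub>A\<^esub> w"]
      inv[of "p \<otimes>\<^bsub>A\<^esub> r \<otimes>\<^bsub>A\<^esub> v" "u \<otimes>\<^bsub>A\<^esub> w \<otimes>\<^bsub>A\<^esub> q"] by (simp add: A.inv_mult A.m_ac)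
  show ?thesis
  proof (cases "\<alpha> \<in> carrier K \<times> carrier K \<rightarrow>\<^sub>E carrier A \<and> \<mu> \<in> carrier K \<times> carrier K \<rightarrow>\<^sub>E carrier A")
    case True
    then have "\<alpha> (x, y) \<in> carrier A" "\<mu> (x, y) \<in> carrier A"
      if "x \<in> carrier K" "y \<in> carrier K" for x y
      using that by auto
    then show ?thesis
      using True by (simp add: cocycle_def e4 e6 cong: ball_cong)
  qed (auto simp: cocycle_def)
qed

lemma cocycle_map:
  assumes "skew_brace K" "comm_group A" "comm_group B" "f \<in> hom A B" "cocycle K A \<alpha> \<mu>"
  shows "cocycle K B (compose (carrier K \<times> carrier K) f \<alpha>) (compose (carrier K \<times> carrier K) f \<mu>)"
proof -
  interpret K: skew_brace K by fact
  interpret A: comm_group A by fact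
  interpret B: comm_group B by fact
  have f: "f \<one>\<^bsub>A\<^esub> = \<one>\<^bsub>B\<^esub>" "\<And>x. x \<in> carrier A \<Longrightarrow> f x \<in> carrier B"
    using assms(4) by (auto simp: hom_one A.is_group B.is_group hom_def)
  have m2: "f p \<otimes>\<^bsub>B\<^esub> f q = f r \<otimes>\<^bsub>B\<^esub> f s" if "p \<otimes>\<^bsub>A\<^esub> q = r \<otimes>\<^bsub>A\<^esub> s"
    "p \<in> carrier A" "q \<in> carrier A" "r \<in> carrier A" "s \<in> carrier A" for p q r s
    using that by (simp flip: hom_mult[OF assms(4)])
  have m3: "f p \<otimes>\<^bsub>B\<^esub> f q \<otimes>\<^bsub>B\<^esub> f u = f r \<otimes>\<^bsub>B\<^esub> f s \<otimes>\<^bsub>B\<^esub> f v"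
    if "p \<otimes>\<^bsub>A\<^esub> q \<otimes>\<^bsub>A\<^esub> u = r \<otimes>\<^bsub>A\<^esub> s \<otimes>\<^bsub>A\<^esub> v"
    "p \<in> carrier A" "q \<in> carrier A" "r \<in> carrier A" "s \<in> carrier A" "u \<in> carrier A"
    "v \<in> carrier A" for p q r s u v
    using that by (simp flip: hom_mult[OF assms(4)])
  have cl: "\<alpha> (x, y) \<in> carrier A" "\<mu> (x, y) \<in> carrier A"
    if "x \<in> carrier K" "y \<in> carrier K" for x y
    using assms(5) that by (auto simp: cocycle_def)
  show ?thesis
    using assms(5) unfolding cocycle_iff[OF assms(1,2)] cocycle_iff[OF assms(1,3)]
    by (auto simp: compose_def f cl intro!: m2 m3)
qed

lemma cocycle_prod:
  assumes "skew_brace K" "comm_group A" "cocycle K A \<alpha> \<mu>" "cocycle K A \<beta> \<nu>"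
  shows "cocycle K A (\<lambda>p\<in>carrier K \<times> carrier K. \<alpha> p \<otimes>\<^bsub>A\<^esub> \<beta> p)
    (\<lambda>p\<in>carrier K \<times> carrier K. \<mu> p \<otimes>\<^bsub>A\<^esub> \<nu> p)"
proof -
  interpret K: skew_brace K by fact
  interpret A: comm_group A by fact
  have m2: "(p \<otimes>\<^bsub>A\<^esub> p') \<otimes>\<^bsub>A\<^esub> (q \<otimes>\<^bsub>A\<^esub> q') = (r \<otimes>\<^bsub>A\<^esub> r') \<otimes>\<^bsub>A\<^esub> (s \<otimes>\<^bsub>A\<^esub> s')"
    if "p \<otimes>\<^bsub>A\<^esub> q = r \<otimes>\<^bsub>A\<^esub> s" "p' \<otimes>\<^bsub>A\<^esub> q' = r' \<otimes>\<^bsub>A\<^esub> s'"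
    "p \<in> carrier A" "q \<in> carrier A" "r \<in> carrier A" "s \<in> carrier A"
    "p' \<in> carrier A" "q' \<in> carrier A" "r' \<in> carrier A" "s' \<in> carrier A" for p q r s p' q' r' s'
  proof -
    have "(p \<otimes>\<^bsub>A\<^esub> p') \<otimes>\<^bsub>A\<^esub> (q \<otimes>\<^bsub>A\<^esub> q') = (p \<otimes>\<^bsub>A\<^esub> q) \<otimes>\<^bsub>A\<^esub> (p' \<otimes>\<^bsub>A\<^esub> q')"
      using that(3-) by (simp add: A.m_ac)
    also have "\<dots> = (r \<otimes>\<^bsub>A\<^esub> r') \<otimes>\<^bsub>A\<^esub> (s \<otimes>\<^bsub>A\<^esub> s')"
      unfolding that(1,2) using that(3-) by (simp add: A.m_ac)
    finally show ?thesis .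
  qed
  have m3: "(p \<otimes>\<^bsub>A\<^esub> p') \<otimes>\<^bsub>A\<^esub> (q \<otimes>\<^bsub>A\<^esub> q') \<otimes>\<^bsub>A\<^esub> (u \<otimes>\<^bsub>A\<^esub> u') =
      (r \<otimes>\<^bsub>A\<^esub> r') \<otimes>\<^bsub>A\<^esub> (s \<otimes>\<^bsub>A\<^esub> s') \<otimes>\<^bsub>A\<^esub> (v \<otimes>\<^bsub>A\<^esub> v')"
    if "p \<otimes>\<^bsub>A\<^esub> q \<otimes>\<^bsub>A\<^esub> u = r \<otimes>\<^bsub>A\<^esub> s \<otimes>\<^bsub>A\<^esub> v" "p' \<otimes>\<^bsub>A\<^esub> q' \<otimes>\<^bsub>A\<^esub> u' = r' \<otimes>\<^bsub>A\<^esub> s' \<otimes>\<^bsub>A\<^esub> v'"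
    "p \<in> carrier A" "q \<in> carrier A" "r \<in> carrier A" "s \<in> carrier A" "u \<in> carrier A" "v \<in> carrier A"
    "p' \<in> carrier A" "q' \<in> carrier A" "r' \<in> carrier A" "s' \<in> carrier A" "u' \<in> carrier A"
    "v' \<in> carrier A" for p q r s u v p' q' r' s' u' v'
  proof -
    have "(p \<otimes>\<^bsub>A\<^esub> p') \<otimes>\<^bsub>A\<^esub> (q \<otimes>\<^bsub>A\<^esub> q') \<otimes>\<^bsub>A\<^esub> (u \<otimes>\<^bsub>A\<^esub> u') =
        (p \<otimes>\<^bsub>A\<^esub> q \<otimes>\<^bsub>A\<^esub> u) \<otimes>\<^bsub>A\<^esub> (p' \<otimes>\<^bsub>A\<^esub> q' \<otimes>\<^bsub>A\<^esub> u')"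
      using that(3-) by (simp add: A.m_ac)
    also have "\<dots> = (r \<otimes>\<^bsub>A\<^esub> r') \<otimes>\<^bsub>A\<^esub> (s \<otimes>\<^bsub>A\<^esub> s') \<otimes>\<^bsub>A\<^esub> (v \<otimes>\<^bsub>A\<^esub> v')"
      unfolding that(1,2) using that(3-) by (simp add: A.m_ac)
    finally show ?thesis .
  qed
  have cl: "\<alpha> (x, y) \<in> carrier A" "\<mu> (x, y) \<in> carrier A"
    "\<beta> (x, y) \<in> carrier A" "\<nu> (x, y) \<in> carrier A"
    if "x \<in> carrier K" "y \<in> carrier K" for x y
    using assms(3,4) that by (auto simp: cocycle_def)
  have one: "\<alpha> (\<one>\<^bsub>K\<^esub>, x) = \<one>\<^bsub>A\<^esub>" "\<alpha> (x, \<one>\<^bsub>K\<^esub>) = \<one>\<^bsub>A\<^esub>" "\<mu> (\<one>\<^bsub>K\<^esub>, x) = \<one>\<^bsub>A\<^esub>"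
      "\<mu> (x, \<one>\<^bsub>K\<^esub>) = \<one>\<^bsub>A\<^esub>" "\<beta> (\<one>\<^bsub>K\<^esub>, x) = \<one>\<^bsub>A\<^esub>" "\<beta> (x, \<one>\<^bsub>K\<^esub>) = \<one>\<^bsub>A\<^esub>"
      "\<nu> (\<one>\<^bsub>K\<^esub>, x) = \<one>\<^bsub>A\<^esub>" "\<nu> (x, \<one>\<^bsub>K\<^esub>) = \<one>\<^bsub>A\<^esub>" if "x \<in> carrier K" for x
    using assms(3,4) that unfolding cocycle_def by blast+
  have E: "\<alpha> (y, z) \<otimes>\<^bsub>A\<^esub> \<alpha> (x, y \<otimes>\<^bsub>K\<^esub> z) = \<alpha> (x, y) \<otimes>\<^bsub>A\<^esub> \<alpha> (x \<otimes>\<^bsub>K\<^esub> y, z)"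
      "\<mu> (y, z) \<otimes>\<^bsub>A\<^esub> \<mu> (x, y \<circledcirc>\<^bsub>K\<^esub> z) = \<mu> (x, y) \<otimes>\<^bsub>A\<^esub> \<mu> (x \<circledcirc>\<^bsub>K\<^esub> y, z)"
      "\<alpha> (y, z) \<otimes>\<^bsub>A\<^esub> \<alpha> (x, lam K x z) \<otimes>\<^bsub>A\<^esub> \<mu> (x, y \<otimes>\<^bsub>K\<^esub> z) =
        \<mu> (x, y) \<otimes>\<^bsub>A\<^esub> \<mu> (x, z) \<otimes>\<^bsub>A\<^esub> \<alpha> (x \<circledcirc>\<^bsub>K\<^esub> y, lam K x z)"
      "\<beta> (y, z) \<otimes>\<^bsub>A\<^esub> \<beta> (x, y \<otimes>\<^bsub>K\<^esub> z) = \<beta> (x, y) \<otimes>\<^bsub>A\<^esub> \<beta> (x \<otimes>\<^bsub>K\<^esub> y, z)"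
      "\<nu> (y, z) \<otimes>\<^bsub>A\<^esub> \<nu> (x, y \<circledcirc>\<^bsub>K\<^esub> z) = \<nu> (x, y) \<otimes>\<^bsub>A\<^esub> \<nu> (x \<circledcirc>\<^bsub>K\<^esub> y, z)"
      "\<beta> (y, z) \<otimes>\<^bsub>A\<^esub> \<beta> (x, lam K x z) \<otimes>\<^bsub>A\<^esub> \<nu> (x, y \<otimes>\<^bsub>K\<^esub> z) =
        \<nu> (x, y) \<otimes>\<^bsub>A\<^esub> \<nu> (x, z) \<otimes>\<^bsub>A\<^esub> \<beta> (x \<circledcirc>\<^bsub>K\<^esub> y, lam K x z)"
    if "x \<in> carrier K" "y \<in> carrier K" "z \<in> carrier K" for x y z
    using assms(3,4) that unfolding cocycle_iff[OF assms(1,2)] by blast+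
  show ?thesis
    unfolding cocycle_iff[OF assms(1,2)]
  proof (intro conjI ballI, goal_cases)
    case 1
    show ?case by (auto simp: cl)
  next
    case 2
    show ?case by (auto simp: cl)
  next
    case (7 x y z)
    then show ?case using m2[OF E(1) E(4), of x y z x y z] by (simp add: cl)
  next
    case (8 x y z)
    then show ?case using m2[OF E(2) E(5), of x y z x y z] by (simp add: cl)
  next
    case (9 x y z)
    then show ?case using m3[OF E(3) E(6), of x y z x y z] by (simp add: cl)
  qed (simp_all add: one)
qed

lemma comm_group_Z2b:
  assumes "skew_brace K" "comm_group A"
  shows "comm_group (Z2b K A)"
proof -
  interpret K: skew_brace K by fact
  interpret A: comm_group A by fact
  have ext: "f = g" if "f \<in> carrier K \<times> carrier K \<rightarrow>\<^sub>E carrier A"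
    "g \<in> carrier K \<times> carrier K \<rightarrow>\<^sub>E carrier A"
    "\<And>x y. x \<in> carrier K \<Longrightarrow> y \<in> carrier K \<Longrightarrow> f (x, y) = g (x, y)" for f g
    using that by (intro PiE_ext[of f _ _ g]) auto
  have PiE: "\<alpha> \<in> carrier K \<times> carrier K \<rightarrow>\<^sub>E carrier A \<and> \<mu> \<in> carrier K \<times> carrier K \<rightarrow>\<^sub>E carrier A \<and>
      (\<forall>x\<in>carrier K. \<forall>y\<in>carrier K. \<alpha> (x, y) \<in> carrier A \<and> \<mu> (x, y) \<in> carrier A)"
    if "cocycle K A \<alpha> \<mu>" for \<alpha> \<mu> using that by (auto simp: cocycle_def)
  have invhom: "m_inv A \<in> hom A A" by (auto simp: hom_def A.inv_mult)
  show ?thesis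
  proof (rule comm_groupI, goal_cases)
    case (1 x y)
    then show ?case using cocycle_prod[OF assms] by (auto simp: Z2b_def)
  next
    case 2
    show ?case by (auto simp: Z2b_def cocycle_iff[OF assms])
  next
    case (3 x y z)
    then show ?case by (auto simp: Z2b_def dest!: PiE intro!: restrict_ext A.m_assoc)
  next
    case (4 x y)
    then show ?case by (auto simp: Z2b_def dest!: PiE intro!: restrict_ext A.m_comm)
  next
    case (5 x)
    then show ?case by (auto simp: Z2b_def dest!: PiE intro!: ext)
  next
    case (6 x)
    then obtain \<alpha> \<mu> where x: "x = (\<alpha>, \<mu>)" "cocycle K A \<alpha> \<mu>" by (auto simp: Z2b_def)
    then show ?case
      using cocycle_map[OF assms(1,2,2) invhom x(2)]
      by (intro bexI[of _ "(compose (carrier K \<times> carrier K) (m_inv A) \<alpha>,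
          compose (carrier K \<times> carrier K) (m_inv A) \<mu>)"])
        (auto simp: Z2b_def compose_def dest!: PiE intro!: restrict_ext A.l_inv)
  qed
qed

lemma subgroup_B2b:
  assumes "skew_brace K" "comm_group A"
  shows "subgroup (B2b K A) (Z2b K A)"
proof -
  interpret K: skew_brace K by fact
  interpret A: comm_group A by fact
  interpret Z: comm_group "Z2b K A" by (rule comm_group_Z2b[OF assms])
  have invhom: "m_inv A \<in> hom A A" by (auto simp: hom_def A.inv_mult)
  show ?thesis
  proof (rule Z.subgroupI, goal_cases)
    case 1
    show ?case by (auto simp: B2b_def)
  next
    case 2
    have "\<one>\<^bsub>Z2b K A\<^esub> \<in> carrier (Z2b K A)" by simp
    then have "\<one>\<^bsub>Z2b K A\<^esub> \<in> B2b K A"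
      by (auto simp: B2b_def Z2b_def intro!: bexI[of _ "\<lambda>_. \<one>\<^bsub>A\<^esub>"])
    then show ?case by auto
  next
    case (3 c)
    obtain \<alpha> \<mu> h where c: "c = (\<alpha>, \<mu>)" "(\<alpha>, \<mu>) \<in> carrier (Z2b K A)"
      and h: "h \<in> carrier K \<rightarrow> carrier A" "h \<one>\<^bsub>K\<^esub> = \<one>\<^bsub>A\<^esub>"
        "\<And>x y. x \<in> carrier K \<Longrightarrow> y \<in> carrier K \<Longrightarrow> \<alpha> (x, y) = h x \<otimes>\<^bsub>A\<^esub> h y \<otimes>\<^bsub>A\<^esub> inv\<^bsub>A\<^esub> h (x \<otimes>\<^bsub>K\<^esub> y)"
        "\<And>x y. x \<in> carrier K \<Longrightarrow> y \<in> carrier K \<Longrightarrow> \<mu> (x, y) = h x \<otimes>\<^bsub>A\<^esub> h y \<otimes>\<^bsub>A\<^esub> inv\<^bsub>A\<^esub> h (x \<circledcirc>\<^bsub>K\<^esub> y)"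
      using 3 by (auto simp: B2b_def)
    let ?i = "(compose (carrier K \<times> carrier K) (m_inv A) \<alpha>, compose (carrier K \<times> carrier K) (m_inv A) \<mu>)"
    have coc: "cocycle K A \<alpha> \<mu>" using c by (simp add: Z2b_def)
    have i: "?i \<in> carrier (Z2b K A)"
      using cocycle_map[OF assms(1,2,2) invhom coc] by (simp add: Z2b_def)
    have "?i \<otimes>\<^bsub>Z2b K A\<^esub> c = \<one>\<^bsub>Z2b K A\<^esub>"
      using coc by (auto simp: c(1) Z2b_def compose_def cocycle_def intro!: restrict_ext A.l_inv)
    then have "inv\<^bsub>Z2b K A\<^esub> c = ?i" using i c by (auto intro: Z.inv_equality)
    moreover have "?i \<in> B2b K A"
      unfolding B2b_def using i h(1,2)
      by (auto simp: compose_def h(3,4) A.inv_mult Pi_iff intro!: bexI[of _ "\<lambda>x. inv\<^bsub>A\<^esub> h x"])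
    ultimately show ?case by simp
  next
    case (4 c d)
    obtain \<alpha> \<mu> h where c: "c = (\<alpha>, \<mu>)" "(\<alpha>, \<mu>) \<in> carrier (Z2b K A)"
      and h: "h \<in> carrier K \<rightarrow> carrier A" "h \<one>\<^bsub>K\<^esub> = \<one>\<^bsub>A\<^esub>"
        "\<And>x y. x \<in> carrier K \<Longrightarrow> y \<in> carrier K \<Longrightarrow> \<alpha> (x, y) = h x \<otimes>\<^bsub>A\<^esub> h y \<otimes>\<^bsub>A\<^esub> inv\<^bsub>A\<^esub> h (x \<otimes>\<^bsub>K\<^esub> y)"
        "\<And>x y. x \<in> carrier K \<Longrightarrow> y \<in> carrier K \<Longrightarrow> \<mu> (x, y) = h x \<otimes>\<^bsub>A\<^esub> h y \<otimes>\<^bsub>A\<^esub> inv\<^bsub>A\<^esub> h (x \<circledcirc>\<^bsub>K\<^esub> y)"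
      using 4(1) by (auto simp: B2b_def)
    obtain \<beta> \<nu> g where d: "d = (\<beta>, \<nu>)" "(\<beta>, \<nu>) \<in> carrier (Z2b K A)"
      and g: "g \<in> carrier K \<rightarrow> carrier A" "g \<one>\<^bsub>K\<^esub> = \<one>\<^bsub>A\<^esub>"
        "\<And>x y. x \<in> carrier K \<Longrightarrow> y \<in> carrier K \<Longrightarrow> \<beta> (x, y) = g x \<otimes>\<^bsub>A\<^esub> g y \<otimes>\<^bsub>A\<^esub> inv\<^bsub>A\<^esub> g (x \<otimes>\<^bsub>K\<^esub> y)"
        "\<And>x y. x \<in> carrier K \<Longrightarrow> y \<in> carrier K \<Longrightarrow> \<nu> (x, y) = g x \<otimes>\<^bsub>A\<^esub> g y \<otimes>\<^bsub>A\<^esub> inv\<^bsub>A\<^esub> g (x \<circledcirc>\<^bsub>K\<^esub> y)"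
      using 4(2) by (auto simp: B2b_def)
    have "c \<otimes>\<^bsub>Z2b K A\<^esub> d \<in> carrier (Z2b K A)" using c d Z.m_closed by blast
    moreover have "(\<lambda>x. h x \<otimes>\<^bsub>A\<^esub> g x) \<in> carrier K \<rightarrow> carrier A" using h(1) g(1) by auto
    moreover have "\<forall>x\<in>carrier K. h x \<in> carrier A \<and> g x \<in> carrier A" using h(1) g(1) by auto
    ultimately show ?case
      by (auto simp: c(1) d(1) B2b_def Z2b_def h(2-) g(2-) A.inv_mult A.m_ac
          intro!: bexI[of _ "\<lambda>x. h x \<otimes>\<^bsub>A\<^esub> g x"])
  qed
qed

lemma comm_group_Cstar: "comm_group Cstar"
  by (rule comm_groupI) (auto simp: Cstar_def intro: exI[of _ "inverse _"] left_inverse)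

lemma eps_in_H2b:
  assumes "skew_brace K" "comm_group A" "(\<alpha>, \<mu>) \<in> carrier (Z2b K A)" "\<chi> \<in> char_set A"
  shows "eps K (\<alpha>, \<mu>) \<chi> \<in> carrier (H2b K Cstar)"
proof -
  have "cocycle K Cstar (compose (carrier K \<times> carrier K) \<chi> \<alpha>) (compose (carrier K \<times> carrier K) \<chi> \<mu>)"
    using assms cocycle_map[OF assms(1,2) comm_group_Cstar] by (auto simp: char_set_def Z2b_def)
  then show ?thesis
    by (auto simp: eps_def H2b_def H2b_class_def FactGroup_def RCOSETS_def Z2b_def)
qed

end

theory Submission
  imports Defs "HOL-Algebra.Zassenhaus" "HOL-Algebra.Multiplicative_Group"
begin

text \<open>
  Both conditions are statements about one and the same object, the fibre product
  \<open>L = {(g, h) \<in> G \<times> H. g and h lie over the same element of K}\<close>. It is itself a central extension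
  of \<open>K\<close>, with kernel \<open>A \<times> B\<close> and with the pair of the two given cocycles as cocycle. Its projections
  \<open>L \<rightarrow> G\<close> and \<open>L \<rightarrow> H\<close> are surjective brace homomorphisms, so they map \<open>\<Gamma>\<^sub>2(L)\<close> onto \<open>\<Gamma>\<^sub>2(G)\<close> and
  \<open>\<Gamma>\<^sub>2(H)\<close>. Write \<open>D = \<Gamma>\<^sub>2(L) \<subseteq> G \<times> H\<close>. The theorem follows by showing that each condition is
  equivalent to

    (*) \<open>D\<close> meets \<open>A \<times> 1\<close> and \<open>1 \<times> B\<close> trivially.

  Isomorphisms. The subgroup \<open>D\<close> is generated by the pairs of corresponding commutators and
  corresponding star products. An isomorphism \<open>\<theta>\<close> compatible with the maps \<open>\<phi>\<close> sends the first
  member of each such pair to the second, so \<open>D\<close> is contained in its graph, and (*) follows because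
  \<open>\<theta>\<close> is injective. Conversely, (*) says that both projections are injective on \<open>D\<close>, so \<open>D\<close> is the
  graph of an isomorphism, and this isomorphism is compatible with \<open>\<phi>\<close>
  (\<open>iso_iff_Gamma2_meets_kernels_trivially\<close>).

  Characters. When the cocycle of a central extension of \<open>K\<close> is pushed forward along a character
  \<open>\<chi>\<close> of the kernel, it becomes a coboundary exactly when \<open>\<chi>\<close> extends to a brace homomorphism
  from the whole extension to \<open>\<complex>\<^sup>\<times>\<close>: the values of the extension on the chosen transversal of
  the kernel are the cobounding function \<open>h\<close>. A homomorphism to an abelian group respects both operations exactly
  when it kills \<open>\<Gamma>\<^sub>2\<close>, and \<open>\<complex>\<^sup>\<times>\<close> is divisible, hence injective among
  abelian groups (\<open>extend_partial_hom\<close>); so \<open>\<chi>\<close> extends if and only if it is trivial on the part of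
  \<open>\<Gamma>\<^sub>2\<close> in the kernel (\<open>coboundary_iff_trivial_on_Gamma2\<close>). For \<open>L\<close> and the
  character \<open>(a, b) \<mapsto> \<chi>(a) / \<psi>(b)\<close> this says that \<open>\<epsilon>\<^sub>G(\<chi>) =
  \<epsilon>\<^sub>H(\<psi>)\<close> if and only if \<open>\<chi>(a) = \<psi>(b)\<close> for all \<open>(a, b) \<in> D \<inter> (A
  \<times> B)\<close> (\<open>eps_eq_iff\<close>). If \<open>D\<close> meets \<open>A \<times> 1\<close> trivially, then for given
  \<open>\<chi>\<close> the relation \<open>b \<mapsto> \<chi>(a)\<close> for \<open>(a, b) \<in> D\<close> is a well-defined
  homomorphism on a subgroup of \<open>B\<close>, and any extension of it to \<open>B\<close> is a suitable \<open>\<psi>\<close>.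
  If some \<open>(a, 1) \<in> D\<close> has \<open>a \<noteq> 1\<close>, then a character \<open>\<chi>\<close> with
  \<open>\<chi>(a) \<noteq> 1\<close> has no partner \<open>\<psi>\<close>. Hence the image of \<open>\<epsilon>\<^sub>G\<close>
  lies in the image of \<open>\<epsilon>\<^sub>H\<close> if and only if \<open>D \<inter> (A \<times> 1) = 1\<close>
  (\<open>eps_image_subset_iff\<close>), and symmetrically.
\<close>

section \<open>Homomorphisms into divisible abelian groups\<close>

locale divisible_comm_group = comm_group +
  assumes root_exists: "\<lbrakk>w \<in> carrier G; 0 < n\<rbrakk> \<Longrightarrow> \<exists>z\<in>carrier G. z [^] (n::nat) = w"

lemma DirProd_int_pow:
  assumes "group G" "group H" "x \<in> carrier G" "z \<in> carrier H"
  shows "(x, z) [^]\<^bsub>G \<times>\<times> H\<^esub> (k::int) = (x [^]\<^bsub>G\<^esub> k, z [^]\<^bsub>H\<^esub> k)"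
proof -
  have P: "group (G \<times>\<times> H)" using DirProd_group assms by blast
  have "fst \<in> hom (G \<times>\<times> H) G" "snd \<in> hom (G \<times>\<times> H) H" by (auto simp: hom_def)
  then show ?thesis
    using hom_int_pow[OF _ _ P assms(1), of fst "(x, z)" k] hom_int_pow[OF _ _ P assms(2), of snd "(x, z)" k]
      assms by (auto intro: prod_eqI)
qed

text \<open>A partial homomorphism from \<open>H\<close> to a commutative group is encoded by its graph, a subgroup
  \<open>Q\<close> of the direct product; being single-valued then means meeting \<open>1 \<times> G\<close> trivially. Here is the
  choice of a value at a new point \<open>x\<close>: the constraints come from the powers of \<open>x\<close> in the
  domain, all of which are powers of the least positive one, \<open>x\<^sup>n\<close>. So it suffices that the value is an
  \<open>n\<close>-th root of the value at \<open>x\<^sup>n\<close>; if there is no such power, any value will do.\<close>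

lemma (in divisible_comm_group) compatible_value:
  assumes H: "group H" and Q: "subgroup Q (H \<times>\<times> G)"
    and single: "\<And>z. (\<one>\<^bsub>H\<^esub>, z) \<in> Q \<Longrightarrow> z = \<one>" and x: "x \<in> carrier H"
  shows "\<exists>z\<in>carrier G. \<forall>k::int. \<forall>w. (x [^]\<^bsub>H\<^esub> k, w) \<in> Q \<longrightarrow> w = z [^] k"
proof -
  interpret H: group H by fact
  interpret T: group "H \<times>\<times> G" using DirProd_group H is_group by blast
  interpret Q: subgroup Q "H \<times>\<times> G" by fact
  have Qsub: "w \<in> carrier G" if "(y, w) \<in> Q" for y w using that Q.subset by auto
  have Qpow: "(y [^]\<^bsub>H\<^esub> k, w [^] k) \<in> Q" if "(y, w) \<in> Q" for y w and k :: int
  proof -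
    have "(y, w) \<in> carrier (H \<times>\<times> G)" using that Q.subset by blast
    then show ?thesis
      using T.subgroup_int_pow_closed[OF Q that, of k] DirProd_int_pow[OF H is_group, of y w k] by simp
  qed
  have Qdiff: "(x [^]\<^bsub>H\<^esub> (i - j), v \<otimes> inv w) \<in> Q"
    if "(x [^]\<^bsub>H\<^esub> i, v) \<in> Q" "(x [^]\<^bsub>H\<^esub> j, w) \<in> Q" for i j :: int and v w
    using Q.m_closed[OF that(1) Q.m_inv_closed[OF that(2)]] that Qsub x
    by (simp add: inv_DirProd[OF H is_group] H.int_pow_diff)
  show ?thesis
  proof (cases "\<exists>n>0. \<exists>w. (x [^]\<^bsub>H\<^esub> int n, w) \<in> Q")
    case True
    define n where "n = (LEAST n. n > 0 \<and> (\<exists>w. (x [^]\<^bsub>H\<^esub> int n, w) \<in> Q))"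
    have "n > 0 \<and> (\<exists>w. (x [^]\<^bsub>H\<^esub> int n, w) \<in> Q)"
      unfolding n_def using True by (rule LeastI_ex)
    then obtain w0 where n: "n > 0" and w0: "(x [^]\<^bsub>H\<^esub> int n, w0) \<in> Q" by blast
    have min: "\<not> (x [^]\<^bsub>H\<^esub> int m, w) \<in> Q" if "0 < m" "m < n" for m w
      using not_less_Least[of m "\<lambda>n. n > 0 \<and> (\<exists>w. (x [^]\<^bsub>H\<^esub> int n, w) \<in> Q)"] that
      by (auto simp: n_def)
    obtain z where z: "z \<in> carrier G" "z [^] n = w0"
      using root_exists[OF Qsub[OF w0] n] by blast
    have "w = z [^] k" if kw: "(x [^]\<^bsub>H\<^esub> k, w) \<in> Q" for k :: int and w
    proof -
      define q where "q = k div int n"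
      define r where "r = nat (k mod int n)"
      have r: "k - int n * q = int r" "r < n"
        using n by (simp_all add: q_def r_def minus_mult_div_eq_mod nat_less_iff)
      have "(x [^]\<^bsub>H\<^esub> (int n * q), w0 [^] q) \<in> Q"
        using Qpow[OF w0, of q] x by (simp add: H.int_pow_pow)
      then have rQ: "(x [^]\<^bsub>H\<^esub> int r, w \<otimes> inv (w0 [^] q)) \<in> Q"
        using Qdiff[OF kw] r by metis
      then have "r = 0" using min r by blast
      with rQ have "w \<otimes> inv (w0 [^] q) = \<one>" using single by simp
      then have "w = w0 [^] q"
        using Qsub[OF kw] Qsub[OF w0] by (metis int_pow_closed inv_closed inv_equality inv_inv)
      also have "\<dots> = z [^] k"
        using z r(1) \<open>r = 0\<close> int_pow_pow[of z "int n" q] by (simp add: int_pow_int)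
      finally show ?thesis .
    qed
    then show ?thesis using z by blast
  next
    case False
    have "w = \<one> [^] k" if kw: "(x [^]\<^bsub>H\<^esub> k, w) \<in> Q" for k :: int and w
    proof (cases "k = 0")
      case True
      then show ?thesis using kw single by simp
    next
      case k: False
      have "(x [^]\<^bsub>H\<^esub> \<bar>k\<bar>, if k < 0 then inv w else w) \<in> Q"
        using kw Q.m_inv_closed[OF kw] Qsub x
        by (auto simp: inv_DirProd[OF H is_group] H.int_pow_neg)
      then have "(x [^]\<^bsub>H\<^esub> int (nat \<bar>k\<bar>), if k < 0 then inv w else w) \<in> Q" by simp
      moreover have "nat \<bar>k\<bar> > 0" using k by simp
      ultimately show ?thesis using False by blast
    qed
    then show ?thesis by blast
  qed
qed

text \<open>Divisible abelian groups are injective. The usual statement concerns abelian \<open>H\<close>; the hypothesis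
  on commutators replaces passing to a quotient of a non-abelian \<open>H\<close>, since it makes every subgroup of
  the product that contains \<open>P\<close> normal. A maximal single-valued subgroup containing \<open>P\<close>, given by
  Zorn's lemma, must be defined everywhere: otherwise the cyclic group generated by \<open>(x, z)\<close>, with \<open>z\<close>
  a compatible value, could be adjoined to it.\<close>

lemma (in divisible_comm_group) extend_partial_hom:
  assumes H: "group H" and P: "subgroup P (H \<times>\<times> G)"
    and comm: "\<And>x y. x \<in> carrier H \<Longrightarrow> y \<in> carrier H \<Longrightarrow> (commutator H x y, \<one>) \<in> P"
    and single: "\<And>z. (\<one>\<^bsub>H\<^esub>, z) \<in> P \<Longrightarrow> z = \<one>"
  obtains f where "f \<in> hom H G" "\<And>x z. (x, z) \<in> P \<Longrightarrow> f x = z"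
proof -
  let ?T = "H \<times>\<times> G"
  interpret H: group H by fact
  interpret T: group ?T using DirProd_group H is_group by blast
  define \<A> where "\<A> = {Q. subgroup Q ?T \<and> P \<subseteq> Q \<and> (\<forall>z. (\<one>\<^bsub>H\<^esub>, z) \<in> Q \<longrightarrow> z = \<one>)}"
  have "\<exists>M\<in>\<A>. \<forall>X\<in>\<A>. M \<subseteq> X \<longrightarrow> X = M"
  proof (rule subset_Zorn_nonempty)
    show "\<A> \<noteq> {}" using P single by (auto simp: \<A>_def)
    fix C assume C: "C \<noteq> {}" "subset.chain \<A> C"
    then have CA: "X \<in> \<A>" if "X \<in> C" for X using that by (auto simp: subset_chain_def)
    then have sub: "subgroup X ?T" if "X \<in> C" for X using that by (simp add: \<A>_def)
    obtain X0 where X0: "X0 \<in> C" using C by blast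
    have "subgroup (\<Union>C) ?T"
    proof (rule T.subgroupI)
      show "\<Union>C \<subseteq> carrier ?T" using sub subgroup.subset by blast
      show "\<Union>C \<noteq> {}" using X0 subgroup.one_closed[OF sub[OF X0]] by blast
      show "inv\<^bsub>?T\<^esub> a \<in> \<Union>C" if "a \<in> \<Union>C" for a
        using that subgroup.m_inv_closed[OF sub] by (metis UnionE UnionI)
      fix a b assume "a \<in> \<Union>C" "b \<in> \<Union>C"
      then obtain X Y where XY: "X \<in> C" "Y \<in> C" "a \<in> X" "b \<in> Y" by blast
      then have "X \<subseteq> Y \<or> Y \<subseteq> X" using C(2) by (auto simp: subset_chain_def)
      then obtain Z where Z: "Z \<in> C" "a \<in> Z" "b \<in> Z" using XY by blast
      show "a \<otimes>\<^bsub>?T\<^esub> b \<in> \<Union>C" using subgroup.m_closed[OF sub[OF Z(1)] Z(2,3)] Z(1) by (rule UnionI[rotated])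
    qed
    then show "\<Union>C \<in> \<A>" using CA X0 by (auto simp: \<A>_def)
  qed
  then obtain Q where QA: "Q \<in> \<A>" and max: "\<And>X. X \<in> \<A> \<Longrightarrow> Q \<subseteq> X \<Longrightarrow> X = Q" by blast
  have Q: "subgroup Q ?T" and PQ: "P \<subseteq> Q" and Qsingle: "\<And>z. (\<one>\<^bsub>H\<^esub>, z) \<in> Q \<Longrightarrow> z = \<one>"
    using QA by (auto simp: \<A>_def)
  interpret Q: subgroup Q ?T by fact
  have Qsub: "y \<in> carrier H" "w \<in> carrier G" if "(y, w) \<in> Q" for y w using that Q.subset by auto
  have "Q \<lhd> ?T"
  proof (rule T.normal_invI[OF Q])
    fix t q assume "t \<in> carrier ?T" "q \<in> Q"
    then obtain x z y w where t: "t = (x, z)" "x \<in> carrier H" "z \<in> carrier G"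
      and q: "q = (y, w)" "y \<in> carrier H" "w \<in> carrier G" "(y, w) \<in> Q"
      using Qsub[of "fst q" "snd q"] by (cases t, cases q) auto
    have "z \<otimes> w \<otimes> inv z = w" using t q by (simp add: m_comm[of z w] m_assoc)
    then have "t \<otimes>\<^bsub>?T\<^esub> q \<otimes>\<^bsub>?T\<^esub> inv\<^bsub>?T\<^esub> t = (commutator H x y, \<one>) \<otimes>\<^bsub>?T\<^esub> q"
      using t q by (simp add: inv_DirProd[OF H is_group] commutator_def H.m_assoc)
    then show "t \<otimes>\<^bsub>?T\<^esub> q \<otimes>\<^bsub>?T\<^esub> inv\<^bsub>?T\<^esub> t \<in> Q"
      using Q.m_closed[OF subsetD[OF PQ comm[OF t(2) q(2)]] \<open>q \<in> Q\<close>] by simp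
  qed
  have total: "\<exists>z. (x, z) \<in> Q" if x: "x \<in> carrier H" for x
  proof -
    obtain z where z: "z \<in> carrier G"
      and zval: "\<And>(k::int) w. (x [^]\<^bsub>H\<^esub> k, w) \<in> Q \<Longrightarrow> w = z [^] k"
      using compatible_value[OF H Q Qsingle x] by blast
    define R where "R = generate ?T {(x, z)}"
    have xz: "(x, z) \<in> carrier ?T" using x z by simp
    have R: "R = {(x [^]\<^bsub>H\<^esub> k, z [^] k) | k. k \<in> (UNIV :: int set)}"
      unfolding R_def using T.generate_pow[OF xz] by (simp add: DirProd_int_pow H is_group x z)
    have Rsub: "subgroup R ?T" unfolding R_def using xz by (intro T.generate_is_subgroup) simp
    let ?X = "Q <#>\<^bsub>?T\<^esub> R"
    have X: "subgroup ?X ?T" using T.mult_norm_subgroup[OF \<open>Q \<lhd> ?T\<close> Rsub] .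
    have "w = \<one>" if wX: "(\<one>\<^bsub>H\<^esub>, w) \<in> ?X" for w
    proof -
      obtain y v and k :: int where yv: "(y, v) \<in> Q"
        and e: "\<one>\<^bsub>H\<^esub> = y \<otimes>\<^bsub>H\<^esub> x [^]\<^bsub>H\<^esub> k" "w = v \<otimes> z [^] k"
      proof -
        obtain q r where "q \<in> Q" "r \<in> R" "(\<one>\<^bsub>H\<^esub>, w) = q \<otimes>\<^bsub>?T\<^esub> r"
          using wX unfolding set_mult_def by blast
        moreover from this obtain k :: int where "r = (x [^]\<^bsub>H\<^esub> k, z [^] k)" by (auto simp: R)
        ultimately show ?thesis using that by (cases q) simp
      qed
      have "y = x [^]\<^bsub>H\<^esub> (-k)"
        using e(1) Qsub[OF yv] x H.inv_equality[of y "x [^]\<^bsub>H\<^esub> k"] by (simp add: H.int_pow_neg)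
      then have "v = z [^] (-k)" using zval[of "-k" v] yv by simp
      then show "w = \<one>" using e(2) z by (simp add: int_pow_neg)
    qed
    moreover have QX: "Q \<subseteq> ?X"
    proof
      fix q assume q: "q \<in> Q"
      have "q = q \<otimes>\<^bsub>?T\<^esub> \<one>\<^bsub>?T\<^esub>" using q Q.subset by (metis T.r_one subsetD)
      then show "q \<in> ?X" using q subgroup.one_closed[OF Rsub] unfolding set_mult_def by blast
    qed
    ultimately have "?X \<in> \<A>" using X PQ by (auto simp: \<A>_def)
    then have "?X = Q" using max QX by blast
    moreover have "(x, z) \<in> ?X"
    proof -
      have "(x, z) = \<one>\<^bsub>?T\<^esub> \<otimes>\<^bsub>?T\<^esub> (x, z)" using T.l_one[OF xz] by simp
      then show ?thesis using Q.one_closed generate.incl[of "(x, z)" "{(x, z)}" ?T]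
        unfolding set_mult_def R_def by blast
    qed
    ultimately show ?thesis by blast
  qed
  have unique: "w = v" if "(x, w) \<in> Q" "(x, v) \<in> Q" for x w v
  proof -
    have "(\<one>\<^bsub>H\<^esub>, w \<otimes> inv v) \<in> Q"
      using Q.m_closed[OF that(1) Q.m_inv_closed[OF that(2)]] that Qsub
      by (simp add: inv_DirProd[OF H is_group])
    then have "w \<otimes> inv v = \<one>" by (rule Qsingle)
    then show "w = v" using Qsub that by (metis inv_closed inv_equality inv_inv)
  qed
  define f where "f x = (THE z. (x, z) \<in> Q)" for x
  have f: "f x = z" if "(x, z) \<in> Q" for x z
    unfolding f_def using that unique by blast
  have "f \<in> hom H G"
  proof (rule homI)
    fix x y assume x: "x \<in> carrier H" and y: "y \<in> carrier H"
    obtain z w where zw: "(x, z) \<in> Q" "(y, w) \<in> Q" using total x y by blast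
    then show "f x \<in> carrier G" using f Qsub by metis
    have "(x \<otimes>\<^bsub>H\<^esub> y, z \<otimes> w) \<in> Q" using Q.m_closed[OF zw] by simp
    then show "f (x \<otimes>\<^bsub>H\<^esub> y) = f x \<otimes> f y" using f zw by metis
  qed
  then show ?thesis using that f PQ by blast
qed

lemma Cstar_nat_pow: "z [^]\<^bsub>Cstar\<^esub> (n::nat) = z ^ n"
  by (induction n) (simp_all add: Cstar_def)

lemma divisible_Cstar: "divisible_comm_group Cstar"
proof (rule divisible_comm_group.intro[OF comm_group_Cstar], unfold_locales)
  fix w :: complex and n :: nat assume w: "w \<in> carrier Cstar" and n: "0 < n"
  then have "card {z. z ^ n = w} \<noteq> 0" using card_nth_roots[of w n] by (simp add: Cstar_def)
  then obtain z where "z ^ n = w" by (metis (mono_tags) card.empty empty_Collect_eq)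
  then show "\<exists>z\<in>carrier Cstar. z [^]\<^bsub>Cstar\<^esub> n = w"
    using w n by (intro bexI[of _ z]) (auto simp: Cstar_nat_pow, auto simp: Cstar_def)
qed

text \<open>The relation sending \<open>a\<close> to \<open>z\<close> generates a partial homomorphism as soon as the order of \<open>z\<close>
  divides the order of \<open>a\<close>. If \<open>a\<close> has infinite order (coded as \<open>ord a = 0\<close>), this leaves \<open>z\<close>
  arbitrary; otherwise a nontrivial root of unity is available.\<close>

lemma chars_separate_points:
  assumes A: "comm_group A" and a: "a \<in> carrier A" "a \<noteq> \<one>\<^bsub>A\<^esub>"
  obtains \<chi> where "\<chi> \<in> char_set A" "\<chi> a \<noteq> 1"
proof -
  interpret A: comm_group A by fact
  interpret C: divisible_comm_group Cstar by (rule divisible_Cstar)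
  interpret T: group "A \<times>\<times> Cstar" using DirProd_group A.is_group C.is_group by blast
  obtain z :: complex where z: "z \<noteq> 0" "z \<noteq> 1" "z ^ A.ord a = 1"
  proof (cases "A.ord a = 0")
    case True
    then show ?thesis using that[of 2] by simp
  next
    case False
    moreover have "A.ord a \<noteq> 1" using a A.ord_eq_1 by blast
    ultimately have "card {z::complex. z ^ A.ord a = 1} > card {1::complex}"
      using card_roots_unity_eq[of "A.ord a"] by simp
    then have "\<not> {z::complex. z ^ A.ord a = 1} \<subseteq> {1}"
      by (meson card_mono finite.emptyI finite.insertI not_less)
    then obtain z :: complex where "z ^ A.ord a = 1" "z \<noteq> 1" by blast
    moreover from this have "z \<noteq> 0" using False by (auto simp: zero_power)
    ultimately show ?thesis using that by blast
  qed
  have zC: "z \<in> carrier Cstar" using z by (simp add: Cstar_def)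
  have az: "(a, z) \<in> carrier (A \<times>\<times> Cstar)" using a zC by simp
  define P where "P = generate (A \<times>\<times> Cstar) {(a, z)}"
  have P: "P = {(a [^]\<^bsub>A\<^esub> k, z [^]\<^bsub>Cstar\<^esub> k) | k. k \<in> (UNIV :: int set)}"
    unfolding P_def using T.generate_pow[OF az] a zC
    by (simp add: DirProd_int_pow A.is_group C.is_group)
  obtain f where f: "f \<in> hom A Cstar" "\<And>x w. (x, w) \<in> P \<Longrightarrow> f x = w"
  proof (rule C.extend_partial_hom[OF A.is_group, of P])
    show P': "subgroup P (A \<times>\<times> Cstar)" unfolding P_def using az by (intro T.generate_is_subgroup) simp
    show "(commutator A x y, \<one>\<^bsub>Cstar\<^esub>) \<in> P" if "x \<in> carrier A" "y \<in> carrier A" for x y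
    proof -
      have "commutator A x y = \<one>\<^bsub>A\<^esub>" using that A.m_comm[of x y]
        by (simp add: commutator_def) (simp add: A.m_assoc)
      then show ?thesis using subgroup.one_closed[OF P'] by simp
    qed
    show "w = \<one>\<^bsub>Cstar\<^esub>" if w: "(\<one>\<^bsub>A\<^esub>, w) \<in> P" for w
    proof -
      obtain k :: int where k: "a [^]\<^bsub>A\<^esub> k = \<one>\<^bsub>A\<^esub>" "w = z [^]\<^bsub>Cstar\<^esub> k" using w by (auto simp: P)
      then have "int (A.ord a) dvd k" using a A.int_pow_eq_id by blast
      moreover have "z [^]\<^bsub>Cstar\<^esub> int (A.ord a) = \<one>\<^bsub>Cstar\<^esub>"
        using z by (simp add: int_pow_int Cstar_nat_pow) (simp add: Cstar_def)
      ultimately show ?thesis using k(2) zC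
        by (metis C.int_pow_one C.int_pow_pow dvdE)
    qed
  qed (use that in blast)
  have "(a, z) \<in> P" unfolding P_def by (rule generate.incl) simp
  then show ?thesis using that[of f] f z by (simp add: char_set_def)
qed


section \<open>Homomorphisms of skew braces and the ideal generated by commutators and star products\<close>

definition brace_hom :: "('a, 'm) sbrace_scheme \<Rightarrow> ('b, 'n) sbrace_scheme \<Rightarrow> ('a \<Rightarrow> 'b) set" where
  "brace_hom G H = hom G H \<inter> hom (circ_group G) (circ_group H)"

lemma brace_homI:
  assumes "\<And>x. x \<in> carrier G \<Longrightarrow> f x \<in> carrier H"
    and "\<And>x y. x \<in> carrier G \<Longrightarrow> y \<in> carrier G \<Longrightarrow> f (x \<otimes>\<^bsub>G\<^esub> y) = f x \<otimes>\<^bsub>H\<^esub> f y"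
    and "\<And>x y. x \<in> carrier G \<Longrightarrow> y \<in> carrier G \<Longrightarrow> f (x \<circledcirc>\<^bsub>G\<^esub> y) = f x \<circledcirc>\<^bsub>H\<^esub> f y"
  shows "f \<in> brace_hom G H"
  using assms by (auto simp: brace_hom_def hom_def circ_group_def)

lemma brace_homD:
  assumes "f \<in> brace_hom G H"
  shows "f \<in> hom G H"
    and "x \<in> carrier G \<Longrightarrow> f x \<in> carrier H"
    and "x \<in> carrier G \<Longrightarrow> y \<in> carrier G \<Longrightarrow> f (x \<otimes>\<^bsub>G\<^esub> y) = f x \<otimes>\<^bsub>H\<^esub> f y"
    and "x \<in> carrier G \<Longrightarrow> y \<in> carrier G \<Longrightarrow> f (x \<circledcirc>\<^bsub>G\<^esub> y) = f x \<circledcirc>\<^bsub>H\<^esub> f y"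
  using assms by (auto simp: brace_hom_def hom_def circ_group_def)

context skew_brace
begin

lemma commutator_closed [simp]:
  "x \<in> carrier A \<Longrightarrow> y \<in> carrier A \<Longrightarrow> commutator A x y \<in> carrier A"
  by (simp add: commutator_def)

lemma star_closed [simp]:
  "x \<in> carrier A \<Longrightarrow> y \<in> carrier A \<Longrightarrow> star A x y \<in> carrier A"
  by (simp add: star_def)

lemma circ_eq_mult_star:
  assumes "x \<in> carrier A" "y \<in> carrier A"
  shows "x \<circledcirc> y = x \<otimes> star A x y \<otimes> y"
  using assms by (simp add: star_def lam_def m_assoc) (simp flip: m_assoc)

lemma subgroup_Gamma2: "subgroup (Gamma2_set A) A"
  unfolding Gamma2_set_def by (rule generate_is_subgroup) auto

lemma commutator_in_Gamma2:
  "x \<in> carrier A \<Longrightarrow> y \<in> carrier A \<Longrightarrow> commutator A x y \<in> Gamma2_set A"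
  unfolding Gamma2_set_def by (rule generate.incl) blast

lemma star_in_Gamma2:
  "x \<in> carrier A \<Longrightarrow> y \<in> carrier A \<Longrightarrow> star A x y \<in> Gamma2_set A"
  unfolding Gamma2_set_def by (rule generate.incl) blast

lemma Gamma2_circ_closed:
  assumes "x \<in> Gamma2_set A" "y \<in> Gamma2_set A"
  shows "x \<circledcirc> y \<in> Gamma2_set A"
proof -
  note S = subgroup_Gamma2
  have "x \<in> carrier A" "y \<in> carrier A" using subgroup.mem_carrier[OF S] assms by auto
  then show ?thesis
    using assms star_in_Gamma2[of x y] subgroup.m_closed[OF S] by (simp add: circ_eq_mult_star)
qed

lemma Gamma2_minimal:
  assumes "subgroup S A"
    and "\<And>x y. x \<in> carrier A \<Longrightarrow> y \<in> carrier A \<Longrightarrow> commutator A x y \<in> S \<and> star A x y \<in> S"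
  shows "Gamma2_set A \<subseteq> S"
  unfolding Gamma2_set_def by (rule generate_subgroup_incl[OF _ assms(1)]) (use assms(2) in auto)

text \<open>The next two lemmas say that \<open>\<Gamma>\<^sub>2\<close> is the obstruction to a brace being trivial and abelian:
  among homomorphisms of the first group into a commutative group, those respecting the circle
  operation are the ones that kill \<open>\<Gamma>\<^sub>2\<close>, because \<open>x \<circ> y = x (x * y) y\<close>.\<close>

lemma hom_trivial_on_Gamma2:
  assumes D: "comm_group D" and f: "f \<in> hom A D"
    and circ: "\<And>x y. x \<in> carrier A \<Longrightarrow> y \<in> carrier A \<Longrightarrow> f (x \<circledcirc> y) = f x \<otimes>\<^bsub>D\<^esub> f y"
    and x: "x \<in> Gamma2_set A"
  shows "f x = \<one>\<^bsub>D\<^esub>"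
proof -
  interpret D: comm_group D by fact
  interpret f: group_hom A D f by (unfold_locales) fact
  have "commutator A x y \<in> kernel A D f \<and> star A x y \<in> kernel A D f"
    if "x \<in> carrier A" "y \<in> carrier A" for x y
  proof -
    have "f (commutator A x y) = \<one>\<^bsub>D\<^esub>"
      using that D.m_comm[of "f x" "f y"] by (simp add: commutator_def) (simp add: D.m_assoc)
    moreover have "f (star A x y) = \<one>\<^bsub>D\<^esub>"
      using that by (simp add: star_def lam_def circ) (simp add: D.m_assoc)
    ultimately show ?thesis using that by (simp add: kernel_def)
  qed
  then have "Gamma2_set A \<subseteq> kernel A D f" by (intro Gamma2_minimal f.subgroup_kernel) auto
  then show ?thesis using x by (auto simp: kernel_def)
qed

lemma hom_circ_if_trivial_on_Gamma2:
  assumes D: "group D" and f: "f \<in> hom A D"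
    and triv: "\<And>x. x \<in> Gamma2_set A \<Longrightarrow> f x = \<one>\<^bsub>D\<^esub>"
    and x: "x \<in> carrier A" and y: "y \<in> carrier A"
  shows "f (x \<circledcirc> y) = f x \<otimes>\<^bsub>D\<^esub> f y"
proof -
  interpret D: group D by fact
  interpret f: group_hom A D f by (unfold_locales) fact
  show ?thesis using triv[OF star_in_Gamma2[OF x y]] x y by (simp add: circ_eq_mult_star)
qed

end

lemma brace_hom_commutator_star:
  assumes "skew_brace G" "skew_brace H" "f \<in> brace_hom G H" "x \<in> carrier G" "y \<in> carrier G"
  shows "f (commutator G x y) = commutator H (f x) (f y)"
    and "f (star G x y) = star H (f x) (f y)"
proof -
  interpret G: skew_brace G by fact
  interpret H: skew_brace H by fact
  interpret f: group_hom G H f using brace_homD(1)[OF assms(3)] by unfold_locales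
  show "f (commutator G x y) = commutator H (f x) (f y)"
    using assms(4,5) by (simp add: commutator_def)
  show "f (star G x y) = star H (f x) (f y)"
    using assms(4,5) by (simp add: star_def lam_def brace_homD(4)[OF assms(3)])
qed

lemma brace_hom_Gamma2_image:
  assumes "skew_brace G" "skew_brace H" "f \<in> brace_hom G H" "f ` carrier G = carrier H"
  shows "f ` Gamma2_set G = Gamma2_set H"
proof -
  interpret G: skew_brace G by fact
  interpret H: skew_brace H by fact
  interpret f: group_hom G H f using brace_homD(1)[OF assms(3)] by unfold_locales
  let ?gen = "\<lambda>G. {x. \<exists>a\<in>carrier G. \<exists>b\<in>carrier G. x = star G a b \<or> x = commutator G a b}"
  note fcs = brace_hom_commutator_star[OF assms(1-3)]
  have "f ` ?gen G = ?gen H"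
  proof (intro equalityI subsetI)
    fix y assume "y \<in> f ` ?gen G"
    then obtain a b where "a \<in> carrier G" "b \<in> carrier G" "y = f (star G a b) \<or> y = f (commutator G a b)"
      by auto
    moreover from this have "f a \<in> carrier H" "f b \<in> carrier H" by simp_all
    moreover from calculation have "y = star H (f a) (f b) \<or> y = commutator H (f a) (f b)"
      using fcs[of a b] by simp
    ultimately show "y \<in> ?gen H" by blast
  next
    fix y assume "y \<in> ?gen H"
    then obtain a b where "a \<in> carrier H" "b \<in> carrier H" "y = star H a b \<or> y = commutator H a b" by blast
    moreover from this obtain a' b' where ab: "a' \<in> carrier G" "b' \<in> carrier G" "a = f a'" "b = f b'"
      using assms(4) by (metis imageE)
    ultimately have "y = f (star G a' b') \<or> y = f (commutator G a' b')" using fcs[of a' b'] by simp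
    then show "y \<in> f ` ?gen G" using ab(1,2) by blast
  qed
  then show ?thesis unfolding Gamma2_set_def by (subst f.generate_img[symmetric]) auto
qed

lemma inj_on_subgroup_if_trivial_kernel:
  assumes "group G" "group H" "f \<in> hom G H" "subgroup S G"
    and "\<And>x. x \<in> S \<Longrightarrow> f x = \<one>\<^bsub>H\<^esub> \<Longrightarrow> x = \<one>\<^bsub>G\<^esub>"
  shows "inj_on f S"
proof -
  interpret G: group G by fact
  interpret H: group H by fact
  interpret f: group_hom G H f by unfold_locales fact
  interpret S: subgroup S G by fact
  show ?thesis
  proof (rule inj_onI)
    fix x y assume xy: "x \<in> S" "y \<in> S" "f x = f y"
    then have "x \<otimes>\<^bsub>G\<^esub> inv\<^bsub>G\<^esub> y = \<one>\<^bsub>G\<^esub>" by (intro assms(5)) simp_all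
    then show "x = y" using G.inv_equality[of x "inv\<^bsub>G\<^esub> y"] xy by simp
  qed
qed

section \<open>Central extensions and coboundaries\<close>

locale central_extension =
  fixes K :: "'k sbrace" and A :: "'a monoid" and \<alpha> \<mu> :: "'k \<times> 'k \<Rightarrow> 'a"
  assumes K: "skew_brace K" and A: "comm_group A" and cocycle: "cocycle K A \<alpha> \<mu>"
begin

sublocale K: skew_brace K by (rule K)
sublocale A: comm_group A by (rule A)

abbreviation "G \<equiv> brace_ext A (\<alpha>, \<mu>) K"

sublocale G: skew_brace G by (rule skew_brace_ext[OF K A cocycle])

lemmas cochain_closed [simp] = cocycle_closed[OF K A cocycle]
lemmas cochain_normalized [simp] = cocycle_one[OF K A cocycle]

lemma carrier_ext [simp]: "carrier G = carrier A \<times> carrier K"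
  and one_ext [simp]: "\<one>\<^bsub>G\<^esub> = (\<one>\<^bsub>A\<^esub>, \<one>\<^bsub>K\<^esub>)"
  and mult_ext [simp]: "(a, x) \<otimes>\<^bsub>G\<^esub> (b, y) = (a \<otimes>\<^bsub>A\<^esub> b \<otimes>\<^bsub>A\<^esub> \<alpha> (x, y), x \<otimes>\<^bsub>K\<^esub> y)"
  and circ_ext [simp]: "(a, x) \<circledcirc>\<^bsub>G\<^esub> (b, y) = (a \<otimes>\<^bsub>A\<^esub> b \<otimes>\<^bsub>A\<^esub> \<mu> (x, y), x \<circledcirc>\<^bsub>K\<^esub> y)"
  by (simp_all add: brace_ext_def)

lemma inv_kernel [simp]:
  "a \<in> carrier A \<Longrightarrow> inv\<^bsub>G\<^esub> (a, \<one>\<^bsub>K\<^esub>) = (inv\<^bsub>A\<^esub> a, \<one>\<^bsub>K\<^esub>)"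
  by (rule G.inv_equality) simp_all

lemma kernel_central:
  "a \<in> carrier A \<Longrightarrow> g \<in> carrier G \<Longrightarrow> (a, \<one>\<^bsub>K\<^esub>) \<otimes>\<^bsub>G\<^esub> g = g \<otimes>\<^bsub>G\<^esub> (a, \<one>\<^bsub>K\<^esub>)"
  by (cases g) (simp add: A.m_comm)

lemma subgroup_kernel: "subgroup (ext_kernel A K) G"
  using ext_kernel_ideal[OF K A cocycle] by (simp add: brace_ideal_def normal_def)

lemma kernel_mult:
  "a \<in> carrier A \<Longrightarrow> x \<in> carrier K \<Longrightarrow> (a, \<one>\<^bsub>K\<^esub>) \<otimes>\<^bsub>G\<^esub> (\<one>\<^bsub>A\<^esub>, x) = (a, x)"
  by simp

lemma kernel_coset:
  assumes "a \<in> carrier A" "x \<in> carrier K"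
  shows "ext_kernel A K #>\<^bsub>G\<^esub> (a, x) = ext_kernel A K #>\<^bsub>G\<^esub> (\<one>\<^bsub>A\<^esub>, x)"
proof (rule G.repr_independence[OF _ _ subgroup_kernel, symmetric])
  show "(a, x) \<in> ext_kernel A K #>\<^bsub>G\<^esub> (\<one>\<^bsub>A\<^esub>, x)"
    unfolding r_coset_def using assms kernel_mult[OF assms] by (auto simp: ext_kernel_def)
qed (use assms in simp)

text \<open>Changing the first components multiplies by elements of the annihilator, so commutators and star
  products only depend on the elements of \<open>K\<close> that lie below.\<close>

lemma commutator_star_lift:
  assumes "a \<in> carrier A" "b \<in> carrier A" "x \<in> carrier K" "y \<in> carrier K"
  shows "commutator G (a, x) (b, y) = commutator G (\<one>\<^bsub>A\<^esub>, x) (\<one>\<^bsub>A\<^esub>, y)"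
    and "star G (a, x) (b, y) = star G (\<one>\<^bsub>A\<^esub>, x) (\<one>\<^bsub>A\<^esub>, y)"
proof -
  have "(c, \<one>\<^bsub>K\<^esub>) \<in> Ann G" if "c \<in> carrier A" for c
    using ext_kernel_Ann[OF K A cocycle] that by (auto simp: ext_kernel_def)
  from G.rep_indep[OF this[OF assms(1)] this[OF assms(2)], of "(\<one>\<^bsub>A\<^esub>, x)" "(\<one>\<^bsub>A\<^esub>, y)"]
  show "commutator G (a, x) (b, y) = commutator G (\<one>\<^bsub>A\<^esub>, x) (\<one>\<^bsub>A\<^esub>, y)"
    and "star G (a, x) (b, y) = star G (\<one>\<^bsub>A\<^esub>, x) (\<one>\<^bsub>A\<^esub>, y)"
    using assms by simp_all
qed

lemma phi_lift:
  assumes "x \<in> carrier K" "y \<in> carrier K"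
  shows "phi_comm G (ext_kernel A K #>\<^bsub>G\<^esub> (\<one>\<^bsub>A\<^esub>, x), ext_kernel A K #>\<^bsub>G\<^esub> (\<one>\<^bsub>A\<^esub>, y)) =
      commutator G (\<one>\<^bsub>A\<^esub>, x) (\<one>\<^bsub>A\<^esub>, y)"
    and "phi_star G (ext_kernel A K #>\<^bsub>G\<^esub> (\<one>\<^bsub>A\<^esub>, x), ext_kernel A K #>\<^bsub>G\<^esub> (\<one>\<^bsub>A\<^esub>, y)) =
      star G (\<one>\<^bsub>A\<^esub>, x) (\<one>\<^bsub>A\<^esub>, y)"
  using phi_rep[OF G.skew_brace_axioms subgroup_kernel ext_kernel_Ann[OF K A cocycle]] assms
  by simp_all

lemma carrier_quot:
  "carrier (quot_brace G (ext_kernel A K)) = (\<lambda>x. ext_kernel A K #>\<^bsub>G\<^esub> (\<one>\<^bsub>A\<^esub>, x)) ` carrier K"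
proof -
  have "carrier (quot_brace G (ext_kernel A K)) = (\<lambda>g. ext_kernel A K #>\<^bsub>G\<^esub> g) ` (carrier A \<times> carrier K)"
    by (auto simp: quot_brace_def FactGroup_def RCOSETS_def)
  also have "\<dots> = (\<lambda>(a, x). ext_kernel A K #>\<^bsub>G\<^esub> (\<one>\<^bsub>A\<^esub>, x)) ` (carrier A \<times> carrier K)"
    using kernel_coset by (intro image_cong) auto
  also have "\<dots> = (\<lambda>x. ext_kernel A K #>\<^bsub>G\<^esub> (\<one>\<^bsub>A\<^esub>, x)) ` carrier K"
    by (force simp: image_iff)
  finally show ?thesis .
qed

lemma subgroup_kernel_part:
  assumes "subgroup S G"
  shows "subgroup {a. (a, \<one>\<^bsub>K\<^esub>) \<in> S} A"
proof -
  interpret S: subgroup S G by fact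
  have sub: "{a. (a, \<one>\<^bsub>K\<^esub>) \<in> S} \<subseteq> carrier A" using S.subset by auto
  show ?thesis
  proof (rule A.subgroupI)
    show "{a. (a, \<one>\<^bsub>K\<^esub>) \<in> S} \<noteq> {}" using S.one_closed by auto
    show "inv\<^bsub>A\<^esub> a \<in> {a. (a, \<one>\<^bsub>K\<^esub>) \<in> S}" if "a \<in> {a. (a, \<one>\<^bsub>K\<^esub>) \<in> S}" for a
      using that S.m_inv_closed[of "(a, \<one>\<^bsub>K\<^esub>)"] inv_kernel[OF subsetD[OF sub that]] by simp
    show "a \<otimes>\<^bsub>A\<^esub> b \<in> {a. (a, \<one>\<^bsub>K\<^esub>) \<in> S}"
      if "a \<in> {a. (a, \<one>\<^bsub>K\<^esub>) \<in> S}" "b \<in> {a. (a, \<one>\<^bsub>K\<^esub>) \<in> S}" for a b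
      using that S.m_closed[of "(a, \<one>\<^bsub>K\<^esub>)" "(b, \<one>\<^bsub>K\<^esub>)"] subsetD[OF sub that(1)] subsetD[OF sub that(2)]
      by simp
  qed (rule sub)
qed

text \<open>The homomorphism to be extended lives on \<open>\<Gamma>\<^sub>2(G) A\<close>: it is \<open>1\<close> on \<open>\<Gamma>\<^sub>2(G)\<close> and \<open>\<chi>\<close> on the kernel.
  It is well defined because \<open>\<chi>\<close> is trivial on the intersection, and multiplicative because the kernel
  is central.\<close>

lemma extends_if_trivial_on_Gamma2:
  assumes D: "divisible_comm_group D" and \<chi>: "\<chi> \<in> hom A D"
    and triv: "\<And>a. (a, \<one>\<^bsub>K\<^esub>) \<in> Gamma2_set G \<Longrightarrow> \<chi> a = \<one>\<^bsub>D\<^esub>"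
  obtains f where "f \<in> hom G D" "\<And>a. a \<in> carrier A \<Longrightarrow> f (a, \<one>\<^bsub>K\<^esub>) = \<chi> a"
    "\<And>g. g \<in> Gamma2_set G \<Longrightarrow> f g = \<one>\<^bsub>D\<^esub>"
proof -
  interpret D: divisible_comm_group D by fact
  interpret \<chi>: group_hom A D \<chi> by unfold_locales fact
  interpret T: group "G \<times>\<times> D" by (rule DirProd_group[OF G.is_group D.is_group])
  interpret S: subgroup "Gamma2_set G" G by (rule G.subgroup_Gamma2)
  have Sc: "d \<in> carrier G" if "d \<in> Gamma2_set G" for d using that S.subset by blast
  define P where "P = {(d \<otimes>\<^bsub>G\<^esub> (a, \<one>\<^bsub>K\<^esub>), \<chi> a) | d a. d \<in> Gamma2_set G \<and> a \<in> carrier A}"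
  have PI: "(d \<otimes>\<^bsub>G\<^esub> (a, \<one>\<^bsub>K\<^esub>), \<chi> a) \<in> P" if "d \<in> Gamma2_set G" "a \<in> carrier A" for d a
    using that P_def by blast
  have PE: "\<exists>d a. d \<in> Gamma2_set G \<and> a \<in> carrier A \<and> p = (d \<otimes>\<^bsub>G\<^esub> (a, \<one>\<^bsub>K\<^esub>), \<chi> a)" if "p \<in> P" for p
    using that P_def by blast
  have P: "subgroup P (G \<times>\<times> D)"
  proof (rule T.subgroupI)
    show "P \<subseteq> carrier (G \<times>\<times> D)"
    proof
      fix p assume "p \<in> P"
      then obtain d a where d: "d \<in> carrier G" and a: "a \<in> carrier A" and p: "p = (d \<otimes>\<^bsub>G\<^esub> (a, \<one>\<^bsub>K\<^esub>), \<chi> a)"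
        using PE Sc by blast
      have "d \<otimes>\<^bsub>G\<^esub> (a, \<one>\<^bsub>K\<^esub>) \<in> carrier G" by (rule G.m_closed[OF d]) (use a in simp)
      then show "p \<in> carrier (G \<times>\<times> D)" using p a by (simp only: carrier_DirProd) auto
    qed
    show "P \<noteq> {}" using PI[OF S.one_closed A.one_closed] by blast
    fix p q assume "p \<in> P"
    then obtain d a where d: "d \<in> Gamma2_set G" and a: "a \<in> carrier A" and p: "p = (d \<otimes>\<^bsub>G\<^esub> (a, \<one>\<^bsub>K\<^esub>), \<chi> a)"
      using PE by blast
    have aG: "(a, \<one>\<^bsub>K\<^esub>) \<in> carrier G" using a by simp
    have "inv\<^bsub>G \<times>\<times> D\<^esub> p = (inv\<^bsub>G\<^esub> d \<otimes>\<^bsub>G\<^esub> (inv\<^bsub>A\<^esub> a, \<one>\<^bsub>K\<^esub>), \<chi> (inv\<^bsub>A\<^esub> a))"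
      unfolding p using kernel_central[OF A.inv_closed[OF a] G.inv_closed[OF Sc[OF d]]] a
      by (subst inv_DirProd[OF G.is_group D.is_group])
        (simp_all only: G.m_closed[OF Sc[OF d] aG] \<chi>.hom_closed G.inv_mult_group[OF Sc[OF d] aG]
          inv_kernel \<chi>.hom_inv)
    then show "inv\<^bsub>G \<times>\<times> D\<^esub> p \<in> P" using PI d a S.m_inv_closed A.inv_closed by metis
    assume "q \<in> P"
    then obtain e b where e: "e \<in> Gamma2_set G" and b: "b \<in> carrier A" and q: "q = (e \<otimes>\<^bsub>G\<^esub> (b, \<one>\<^bsub>K\<^esub>), \<chi> b)"
      using PE by blast
    have bG: "(b, \<one>\<^bsub>K\<^esub>) \<in> carrier G" using b by simp
    have ab: "(a \<otimes>\<^bsub>A\<^esub> b, \<one>\<^bsub>K\<^esub>) = (a, \<one>\<^bsub>K\<^esub>) \<otimes>\<^bsub>G\<^esub> (b, \<one>\<^bsub>K\<^esub>)" using a b by simp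
    have "d \<otimes>\<^bsub>G\<^esub> (a, \<one>\<^bsub>K\<^esub>) \<otimes>\<^bsub>G\<^esub> (e \<otimes>\<^bsub>G\<^esub> (b, \<one>\<^bsub>K\<^esub>)) = d \<otimes>\<^bsub>G\<^esub> ((a, \<one>\<^bsub>K\<^esub>) \<otimes>\<^bsub>G\<^esub> e) \<otimes>\<^bsub>G\<^esub> (b, \<one>\<^bsub>K\<^esub>)"
      using Sc[OF d] Sc[OF e] aG bG by (simp only: G.m_assoc G.m_closed)
    also have "\<dots> = d \<otimes>\<^bsub>G\<^esub> e \<otimes>\<^bsub>G\<^esub> (a \<otimes>\<^bsub>A\<^esub> b, \<one>\<^bsub>K\<^esub>)"
      unfolding kernel_central[OF a Sc[OF e]] ab
      using Sc[OF d] Sc[OF e] aG bG by (simp only: G.m_assoc G.m_closed)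
    finally have "p \<otimes>\<^bsub>G \<times>\<times> D\<^esub> q = (d \<otimes>\<^bsub>G\<^esub> e \<otimes>\<^bsub>G\<^esub> (a \<otimes>\<^bsub>A\<^esub> b, \<one>\<^bsub>K\<^esub>), \<chi> (a \<otimes>\<^bsub>A\<^esub> b))"
      unfolding p q mult_DirProd using a b by (simp only: \<chi>.hom_mult)
    then show "p \<otimes>\<^bsub>G \<times>\<times> D\<^esub> q \<in> P" using PI S.m_closed[OF d e] A.m_closed[OF a b] by metis
  qed
  have \<Gamma>P: "(d, \<one>\<^bsub>D\<^esub>) \<in> P" if "d \<in> Gamma2_set G" for d
    using PI[OF that A.one_closed] G.r_one[OF Sc[OF that]] by simp
  obtain f where f: "f \<in> hom G D" "\<And>x z. (x, z) \<in> P \<Longrightarrow> f x = z"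
  proof (rule D.extend_partial_hom[OF G.is_group P])
    show "(commutator G x y, \<one>\<^bsub>D\<^esub>) \<in> P" if "x \<in> carrier G" "y \<in> carrier G" for x y
      using \<Gamma>P G.commutator_in_Gamma2[OF that] by blast
    show "z = \<one>\<^bsub>D\<^esub>" if z: "(\<one>\<^bsub>G\<^esub>, z) \<in> P" for z
    proof -
      obtain d a where d: "d \<in> Gamma2_set G" and a: "a \<in> carrier A"
        and e: "\<one>\<^bsub>G\<^esub> = d \<otimes>\<^bsub>G\<^esub> (a, \<one>\<^bsub>K\<^esub>)" "z = \<chi> a" using PE[OF z] by blast
      have "inv\<^bsub>G\<^esub> (a, \<one>\<^bsub>K\<^esub>) = d"
        using G.inv_equality[OF e(1)[symmetric]] Sc[OF d] a by simp
      then have "(inv\<^bsub>A\<^esub> a, \<one>\<^bsub>K\<^esub>) \<in> Gamma2_set G" using d a by simp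
      then have "inv\<^bsub>D\<^esub> (\<chi> a) = \<one>\<^bsub>D\<^esub>" using triv[of "inv\<^bsub>A\<^esub> a"] a by simp
      then show ?thesis using e(2) a by (metis D.inv_inv D.inv_one \<chi>.hom_closed)
    qed
  qed blast
  show ?thesis
  proof (rule that[OF f(1)])
    show "f (a, \<one>\<^bsub>K\<^esub>) = \<chi> a" if "a \<in> carrier A" for a
      using f(2)[OF PI[OF S.one_closed that]] that by simp
    show "f g = \<one>\<^bsub>D\<^esub>" if "g \<in> Gamma2_set G" for g using f(2)[OF \<Gamma>P[OF that]] .
  qed
qed

text \<open>A function \<open>h\<close> on \<open>K\<close> cobounds the image of the cocycle under \<open>\<chi>\<close> if and only if
  \<open>(a, x) \<mapsto> \<chi>(a) h(x)\<close> respects both operations of the extension. So the class vanishes exactly when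
  \<open>\<chi>\<close> extends to a brace homomorphism \<open>G \<rightarrow> D\<close>.\<close>

lemma coboundary_iff_trivial_on_Gamma2:
  assumes D: "divisible_comm_group D" and \<chi>: "\<chi> \<in> hom A D"
  shows "(compose (carrier K \<times> carrier K) \<chi> \<alpha>, compose (carrier K \<times> carrier K) \<chi> \<mu>) \<in> B2b K D
    \<longleftrightarrow> (\<forall>a. (a, \<one>\<^bsub>K\<^esub>) \<in> Gamma2_set G \<longrightarrow> \<chi> a = \<one>\<^bsub>D\<^esub>)" (is "?c \<in> _ \<longleftrightarrow> ?triv")
proof
  interpret D: divisible_comm_group D by fact
  interpret \<chi>: group_hom A D \<chi> by unfold_locales fact
  {
    assume "?c \<in> B2b K D"
    then obtain h where hc: "h \<in> carrier K \<rightarrow> carrier D" and h1: "h \<one>\<^bsub>K\<^esub> = \<one>\<^bsub>D\<^esub>"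
      and h: "\<And>x y. x \<in> carrier K \<Longrightarrow> y \<in> carrier K \<Longrightarrow>
          \<chi> (\<alpha> (x, y)) = h x \<otimes>\<^bsub>D\<^esub> h y \<otimes>\<^bsub>D\<^esub> inv\<^bsub>D\<^esub> h (x \<otimes>\<^bsub>K\<^esub> y)"
        "\<And>x y. x \<in> carrier K \<Longrightarrow> y \<in> carrier K \<Longrightarrow>
          \<chi> (\<mu> (x, y)) = h x \<otimes>\<^bsub>D\<^esub> h y \<otimes>\<^bsub>D\<^esub> inv\<^bsub>D\<^esub> h (x \<circledcirc>\<^bsub>K\<^esub> y)"
      by (auto simp: B2b_def compose_def)
    have hcl: "h x \<in> carrier D" if "x \<in> carrier K" for x using hc that by auto
    \<comment> \<open>The homomorphism extending \<open>\<chi>\<close> that is determined by the cobounding function.\<close>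
    define f where "f = (\<lambda>(a, x). \<chi> a \<otimes>\<^bsub>D\<^esub> h x)"
    have step: "p \<otimes>\<^bsub>D\<^esub> q \<otimes>\<^bsub>D\<^esub> (u \<otimes>\<^bsub>D\<^esub> v \<otimes>\<^bsub>D\<^esub> inv\<^bsub>D\<^esub> w) \<otimes>\<^bsub>D\<^esub> w = p \<otimes>\<^bsub>D\<^esub> u \<otimes>\<^bsub>D\<^esub> (q \<otimes>\<^bsub>D\<^esub> v)"
      if "p \<in> carrier D" "q \<in> carrier D" "u \<in> carrier D" "v \<in> carrier D" "w \<in> carrier D" for p q u v w
    proof -
      have "p \<otimes>\<^bsub>D\<^esub> q \<otimes>\<^bsub>D\<^esub> (u \<otimes>\<^bsub>D\<^esub> v \<otimes>\<^bsub>D\<^esub> inv\<^bsub>D\<^esub> w) \<otimes>\<^bsub>D\<^esub> w =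
          p \<otimes>\<^bsub>D\<^esub> q \<otimes>\<^bsub>D\<^esub> (u \<otimes>\<^bsub>D\<^esub> v) \<otimes>\<^bsub>D\<^esub> (inv\<^bsub>D\<^esub> w \<otimes>\<^bsub>D\<^esub> w)"
        using that by (simp only: D.m_assoc D.m_closed D.inv_closed)
      then show ?thesis using that by (simp add: D.m_ac)
    qed
    have f: "f \<in> hom G D"
      by (auto simp: f_def hom_def hcl h step)
    have fc: "f (g \<circledcirc>\<^bsub>G\<^esub> g') = f g \<otimes>\<^bsub>D\<^esub> f g'" if "g \<in> carrier G" "g' \<in> carrier G" for g g'
      using that by (auto simp: f_def hcl h step)
    show ?triv
    proof (intro allI impI)
      fix a assume a: "(a, \<one>\<^bsub>K\<^esub>) \<in> Gamma2_set G"
      then have "a \<in> carrier A" using subgroup.subset[OF G.subgroup_Gamma2] by auto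
      then show "\<chi> a = \<one>\<^bsub>D\<^esub>"
        using G.hom_trivial_on_Gamma2[OF D.comm_group_axioms f fc a] by (simp add: f_def h1)
    qed
  next
    assume ?triv
    then obtain f where f: "f \<in> hom G D" and f\<chi>: "\<And>a. a \<in> carrier A \<Longrightarrow> f (a, \<one>\<^bsub>K\<^esub>) = \<chi> a"
      and f\<Gamma>: "\<And>g. g \<in> Gamma2_set G \<Longrightarrow> f g = \<one>\<^bsub>D\<^esub>"
      using extends_if_trivial_on_Gamma2[OF D \<chi>] by blast
    interpret f: group_hom G D f by unfold_locales fact
    define h where "h x = f (\<one>\<^bsub>A\<^esub>, x)" for x
    have hcl: "h x \<in> carrier D" if "x \<in> carrier K" for x using that by (simp add: h_def)
    have val: "\<chi> a = h x \<otimes>\<^bsub>D\<^esub> h y \<otimes>\<^bsub>D\<^esub> inv\<^bsub>D\<^esub> h z"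
      if "f (a, z) = h x \<otimes>\<^bsub>D\<^esub> h y" "a \<in> carrier A" "x \<in> carrier K" "y \<in> carrier K" "z \<in> carrier K" for a x y z
    proof -
      have "f (a, z) = \<chi> a \<otimes>\<^bsub>D\<^esub> h z"
        using f.hom_mult[of "(a, \<one>\<^bsub>K\<^esub>)" "(\<one>\<^bsub>A\<^esub>, z)"] that by (simp add: f\<chi> h_def)
      then show ?thesis using that hcl by (simp add: D.inv_solve_right)
    qed
    have "\<chi> (\<alpha> (x, y)) = h x \<otimes>\<^bsub>D\<^esub> h y \<otimes>\<^bsub>D\<^esub> inv\<^bsub>D\<^esub> h (x \<otimes>\<^bsub>K\<^esub> y)"
      "\<chi> (\<mu> (x, y)) = h x \<otimes>\<^bsub>D\<^esub> h y \<otimes>\<^bsub>D\<^esub> inv\<^bsub>D\<^esub> h (x \<circledcirc>\<^bsub>K\<^esub> y)"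
      if "x \<in> carrier K" "y \<in> carrier K" for x y
    proof -
      have "f (\<alpha> (x, y), x \<otimes>\<^bsub>K\<^esub> y) = h x \<otimes>\<^bsub>D\<^esub> h y"
        using f.hom_mult[of "(\<one>\<^bsub>A\<^esub>, x)" "(\<one>\<^bsub>A\<^esub>, y)"] that by (simp add: h_def)
      from val[OF this] that
      show "\<chi> (\<alpha> (x, y)) = h x \<otimes>\<^bsub>D\<^esub> h y \<otimes>\<^bsub>D\<^esub> inv\<^bsub>D\<^esub> h (x \<otimes>\<^bsub>K\<^esub> y)" by simp
      have "f (\<mu> (x, y), x \<circledcirc>\<^bsub>K\<^esub> y) = h x \<otimes>\<^bsub>D\<^esub> h y"
        using G.hom_circ_if_trivial_on_Gamma2[OF D.is_group f f\<Gamma>, of "(\<one>\<^bsub>A\<^esub>, x)" "(\<one>\<^bsub>A\<^esub>, y)"] that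
        by (simp add: h_def)
      from val[OF this] that
      show "\<chi> (\<mu> (x, y)) = h x \<otimes>\<^bsub>D\<^esub> h y \<otimes>\<^bsub>D\<^esub> inv\<^bsub>D\<^esub> h (x \<circledcirc>\<^bsub>K\<^esub> y)" by simp
    qed
    moreover have "h \<one>\<^bsub>K\<^esub> = \<one>\<^bsub>D\<^esub>" by (simp add: h_def f\<chi>)
    moreover have "?c \<in> carrier (Z2b K D)"
      using cocycle_map[OF K A D.comm_group_axioms \<chi> cocycle] by (simp add: Z2b_def)
    ultimately show "?c \<in> B2b K D"
      using hcl by (auto simp: B2b_def compose_def intro!: bexI[of _ h])
  }
qed

end


lemma (in comm_group) coset_mult_eq_iff:
  assumes B: "subgroup B G" and b: "b \<in> carrier G" and c: "c \<in> carrier G"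
  shows "B #> (b \<otimes> c) = B #> c \<longleftrightarrow> b \<in> B"
proof
  interpret B: subgroup B G by fact
  {
    assume "B #> (b \<otimes> c) = B #> c"
    then have "b \<otimes> c \<in> B #> c" using rcos_self[OF _ B, of "b \<otimes> c"] b c by simp
    then obtain b' where b': "b' \<in> B" "b \<otimes> c = b' \<otimes> c" by (auto simp: r_coset_def)
    then show "b \<in> B" using b c by (metis B.mem_carrier right_cancel)
  next
    assume "b \<in> B"
    then have "B #> b = B" by (rule coset_join2[OF b B])
    then show "B #> (b \<otimes> c) = B #> c" using coset_mult_assoc[OF B.subset b c] by simp
  }
qed

section \<open>The fibre product of two extensions\<close>

text \<open>Restricted to \<open>S\<close> because cochains are extensional functions.\<close>

definition pair_cochain :: "'s set \<Rightarrow> ('s \<Rightarrow> 'a) \<Rightarrow> ('s \<Rightarrow> 'b) \<Rightarrow> 's \<Rightarrow> 'a \<times> 'b" where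
  "pair_cochain S f g = (\<lambda>p\<in>S. (f p, g p))"

lemma pair_cochain_apply [simp]: "p \<in> S \<Longrightarrow> pair_cochain S f g p = (f p, g p)"
  by (simp add: pair_cochain_def)

lemma comm_group_DirProd:
  assumes "comm_group A" "comm_group B"
  shows "comm_group (A \<times>\<times> B)"
proof -
  interpret A: comm_group A by fact
  interpret B: comm_group B by fact
  interpret group "A \<times>\<times> B" by (rule DirProd_group[OF A.is_group B.is_group])
  show ?thesis by unfold_locales (auto simp: A.m_comm B.m_comm)
qed

lemma cocycle_pair:
  assumes "skew_brace K" "comm_group A" "comm_group B" "cocycle K A \<alpha> \<mu>" "cocycle K B \<beta> \<nu>"
  shows "cocycle K (A \<times>\<times> B) (pair_cochain (carrier K \<times> carrier K) \<alpha> \<beta>)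
    (pair_cochain (carrier K \<times> carrier K) \<mu> \<nu>)"
proof -
  interpret K: skew_brace K by fact
  interpret KA: central_extension K A \<alpha> \<mu> by (rule central_extension.intro[OF assms(1,2,4)])
  interpret KB: central_extension K B \<beta> \<nu> by (rule central_extension.intro[OF assms(1,3,5)])
  have closed: "pair_cochain (carrier K \<times> carrier K) \<alpha> \<beta> \<in> carrier K \<times> carrier K \<rightarrow>\<^sub>E carrier (A \<times>\<times> B)"
    "pair_cochain (carrier K \<times> carrier K) \<mu> \<nu> \<in> carrier K \<times> carrier K \<rightarrow>\<^sub>E carrier (A \<times>\<times> B)"
    by (auto simp: pair_cochain_def)
  show ?thesis
    using assms(4,5)
    unfolding cocycle_iff[OF assms(1,2)] cocycle_iff[OF assms(1,3)]
      cocycle_iff[OF assms(1) comm_group_DirProd[OF assms(2,3)]]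
    by (simp add: closed del: carrier_DirProd)
qed

locale two_extensions =
  GA: central_extension K A \<alpha> \<mu> + HB: central_extension K B \<beta> \<nu>
  for K :: "'k sbrace" and A :: "'a monoid" and \<alpha> \<mu> and B :: "'b monoid" and \<beta> \<nu>
begin

abbreviation "G \<equiv> brace_ext A (\<alpha>, \<mu>) K"
abbreviation "H \<equiv> brace_ext B (\<beta>, \<nu>) K"

abbreviation "KK \<equiv> carrier K \<times> carrier K"

sublocale LL: central_extension K "A \<times>\<times> B" "pair_cochain KK \<alpha> \<beta>" "pair_cochain KK \<mu> \<nu>"
  using GA.K GA.A HB.A GA.cocycle HB.cocycle
  by (intro central_extension.intro comm_group_DirProd cocycle_pair)

text \<open>An element \<open>((a, b), x)\<close> of \<open>L\<close> stands for the pair of \<open>(a, x) \<in> G\<close> and \<open>(b, x) \<in> H\<close>.\<close>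

abbreviation "L \<equiv> brace_ext (A \<times>\<times> B) (pair_cochain KK \<alpha> \<beta>, pair_cochain KK \<mu> \<nu>) K"

abbreviation pG :: "('a \<times> 'b) \<times> 'k \<Rightarrow> 'a \<times> 'k" where "pG \<equiv> map_prod fst id"
abbreviation pH :: "('a \<times> 'b) \<times> 'k \<Rightarrow> 'b \<times> 'k" where "pH \<equiv> map_prod snd id"

lemma pG_hom: "pG \<in> brace_hom L G"
  by (rule brace_homI) auto

lemma pH_hom: "pH \<in> brace_hom L H"
  by (rule brace_homI) auto

lemma pG_surj: "pG ` carrier L = carrier G"
  using HB.A.one_closed by (force simp: image_iff)

lemma pH_surj: "pH ` carrier L = carrier H"
  using GA.A.one_closed by (force simp: image_iff)

lemma pG_Gamma2: "pG ` Gamma2_set L = Gamma2_set G"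
  by (rule brace_hom_Gamma2_image[OF LL.G.skew_brace_axioms GA.G.skew_brace_axioms pG_hom pG_surj])

lemma pH_Gamma2: "pH ` Gamma2_set L = Gamma2_set H"
  by (rule brace_hom_Gamma2_image[OF LL.G.skew_brace_axioms HB.G.skew_brace_axioms pH_hom pH_surj])

section \<open>Comparing the two maps \<open>\<epsilon>\<close>\<close>

text \<open>The quotient of the two cocycles is the image of the cocycle of \<open>L\<close> under the character
  \<open>(a, b) \<mapsto> \<chi>(a) / \<psi>(b)\<close> of \<open>A \<times> B\<close>, so the classes agree if and only if this character is trivial
  on the part of \<open>\<Gamma>\<^sub>2(L)\<close> in the kernel.\<close>

lemma eps_eq_iff:
  assumes \<chi>: "\<chi> \<in> char_set A" and \<psi>: "\<psi> \<in> char_set B"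
  shows "eps K (\<alpha>, \<mu>) \<chi> = eps K (\<beta>, \<nu>) \<psi> \<longleftrightarrow>
    (\<forall>a b. ((a, b), \<one>\<^bsub>K\<^esub>) \<in> Gamma2_set L \<longrightarrow> \<chi> a = \<psi> b)"
proof -
  interpret Z: comm_group "Z2b K Cstar" by (rule comm_group_Z2b[OF GA.K comm_group_Cstar])
  define \<omega> where "\<omega> = (\<lambda>(a, b). \<chi> a / \<psi> b)"
  have nz: "\<chi> a \<noteq> 0" if "a \<in> carrier A" for a
    using \<chi> that by (auto simp: char_set_def hom_def Cstar_def)
  have nz': "\<psi> b \<noteq> 0" if "b \<in> carrier B" for b
    using \<psi> that by (auto simp: char_set_def hom_def Cstar_def)
  have \<omega>: "\<omega> \<in> hom (A \<times>\<times> B) Cstar"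
    using \<chi> \<psi> nz nz' by (auto simp: \<omega>_def char_set_def hom_def Cstar_def)
  let ?cA = "(compose KK \<chi> \<alpha>, compose KK \<chi> \<mu>)"
  let ?cB = "(compose KK \<psi> \<beta>, compose KK \<psi> \<nu>)"
  let ?cL = "(compose KK \<omega> (pair_cochain KK \<alpha> \<beta>), compose KK \<omega> (pair_cochain KK \<mu> \<nu>))"
  have carr: "?cB \<in> carrier (Z2b K Cstar)" "?cL \<in> carrier (Z2b K Cstar)"
    using cocycle_map[OF GA.K HB.A comm_group_Cstar _ HB.cocycle, of \<psi>] \<psi>
      cocycle_map[OF GA.K LL.A comm_group_Cstar \<omega> LL.cocycle]
    by (auto simp: Z2b_def char_set_def)
  have "?cA = ?cL \<otimes>\<^bsub>Z2b K Cstar\<^esub> ?cB"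
    by (auto simp: Z2b_def compose_def pair_cochain_def \<omega>_def Cstar_def nz' fun_eq_iff)
  then have "eps K (\<alpha>, \<mu>) \<chi> = eps K (\<beta>, \<nu>) \<psi> \<longleftrightarrow> ?cL \<in> B2b K Cstar"
    using Z.coset_mult_eq_iff[OF subgroup_B2b[OF GA.K comm_group_Cstar] carr(2,1)]
    by (simp add: eps_def H2b_class_def)
  also have "\<dots> \<longleftrightarrow> (\<forall>c. (c, \<one>\<^bsub>K\<^esub>) \<in> Gamma2_set L \<longrightarrow> \<omega> c = \<one>\<^bsub>Cstar\<^esub>)"
    by (rule LL.coboundary_iff_trivial_on_Gamma2[OF divisible_Cstar \<omega>])
  also have "\<dots> \<longleftrightarrow> (\<forall>a b. ((a, b), \<one>\<^bsub>K\<^esub>) \<in> Gamma2_set L \<longrightarrow> \<chi> a = \<psi> b)"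
  proof -
    have "\<omega> (a, b) = \<one>\<^bsub>Cstar\<^esub> \<longleftrightarrow> \<chi> a = \<psi> b" if "((a, b), \<one>\<^bsub>K\<^esub>) \<in> Gamma2_set L" for a b
      using that subgroup.subset[OF LL.G.subgroup_Gamma2] nz'[of b]
      by (auto simp: \<omega>_def Cstar_def)
    then show ?thesis by auto
  qed
  finally show ?thesis .
qed

text \<open>Left to right, a character not trivial at \<open>a\<close> would contradict \<open>\<chi>(a) = \<psi>(1) = 1\<close>. Right to
  left, the pairs \<open>(b, \<chi>(a))\<close> with \<open>(a, b)\<close> in \<open>\<Gamma>\<^sub>2(L)\<close> form the graph of a partial character of \<open>B\<close>,
  and any extension of it is a partner of \<open>\<chi>\<close>.\<close>

lemma eps_image_subset_iff:
  "eps K (\<alpha>, \<mu>) ` char_set A \<subseteq> eps K (\<beta>, \<nu>) ` char_set B \<longleftrightarrow>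
    (\<forall>a. ((a, \<one>\<^bsub>B\<^esub>), \<one>\<^bsub>K\<^esub>) \<in> Gamma2_set L \<longrightarrow> a = \<one>\<^bsub>A\<^esub>)" (is "?sub \<longleftrightarrow> ?triv")
proof
  assume sub: ?sub
  interpret C: comm_group Cstar by (rule comm_group_Cstar)
  show ?triv
  proof (intro allI impI, rule ccontr)
    fix a assume a: "((a, \<one>\<^bsub>B\<^esub>), \<one>\<^bsub>K\<^esub>) \<in> Gamma2_set L" and "a \<noteq> \<one>\<^bsub>A\<^esub>"
    moreover from a have "a \<in> carrier A" using subgroup.subset[OF LL.G.subgroup_Gamma2] by auto
    ultimately obtain \<chi> where \<chi>: "\<chi> \<in> char_set A" "\<chi> a \<noteq> 1"
      using chars_separate_points[OF GA.A] by blast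
    then obtain \<psi> where \<psi>: "\<psi> \<in> char_set B" "eps K (\<alpha>, \<mu>) \<chi> = eps K (\<beta>, \<nu>) \<psi>" using sub by blast
    then have "\<chi> a = \<psi> \<one>\<^bsub>B\<^esub>" using eps_eq_iff[OF \<chi>(1) \<psi>(1)] a by blast
    also have "\<dots> = 1"
      using hom_one[of \<psi> B Cstar] \<psi>(1) HB.A.is_group C.is_group
      by (simp add: char_set_def Cstar_def)
    finally show False using \<chi>(2) by simp
  qed
next
  assume triv: ?triv
  interpret C: divisible_comm_group Cstar by (rule divisible_Cstar)
  interpret BC: group "B \<times>\<times> Cstar" by (rule DirProd_group[OF HB.A.is_group C.is_group])
  show ?sub
  proof
    fix c assume "c \<in> eps K (\<alpha>, \<mu>) ` char_set A"
    then obtain \<chi> where \<chi>: "\<chi> \<in> char_set A" and c: "c = eps K (\<alpha>, \<mu>) \<chi>" by blast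
    interpret \<chi>: group_hom A Cstar \<chi> using \<chi> by unfold_locales (simp add: char_set_def)
    let ?R = "{c. (c, \<one>\<^bsub>K\<^esub>) \<in> Gamma2_set L}"
    let ?g = "\<lambda>(a, b). (b, \<chi> a)"
    have R: "subgroup ?R (A \<times>\<times> B)" by (rule LL.subgroup_kernel_part[OF LL.G.subgroup_Gamma2])
    have "?g \<in> hom (A \<times>\<times> B) (B \<times>\<times> Cstar)" by (auto simp: hom_def)
    then interpret g: group_hom "A \<times>\<times> B" "B \<times>\<times> Cstar" ?g by unfold_locales
    have P: "subgroup (?g ` ?R) (B \<times>\<times> Cstar)" by (rule g.subgroup_img_is_subgroup[OF R])
    obtain \<psi> where \<psi>: "\<psi> \<in> hom B Cstar" "\<And>b z. (b, z) \<in> ?g ` ?R \<Longrightarrow> \<psi> b = z"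
    proof (rule C.extend_partial_hom[OF HB.A.is_group P])
      show "(commutator B x y, \<one>\<^bsub>Cstar\<^esub>) \<in> ?g ` ?R" if "x \<in> carrier B" "y \<in> carrier B" for x y
      proof -
        have "commutator B x y = \<one>\<^bsub>B\<^esub>" using that HB.A.m_comm[of x y]
          by (simp add: commutator_def) (simp add: HB.A.m_assoc)
        then show ?thesis using subgroup.one_closed[OF P] by simp
      qed
      show "z = \<one>\<^bsub>Cstar\<^esub>" if "(\<one>\<^bsub>B\<^esub>, z) \<in> ?g ` ?R" for z
        using that triv \<chi>.hom_one by auto
    qed blast
    have "\<chi> a = \<psi> b" if "((a, b), \<one>\<^bsub>K\<^esub>) \<in> Gamma2_set L" for a b
    proof -
      have "(b, \<chi> a) \<in> ?g ` ?R" using that by force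
      then show ?thesis using \<psi>(2) by simp
    qed
    then show "c \<in> eps K (\<beta>, \<nu>) ` char_set B"
      using eps_eq_iff[OF \<chi>, of \<psi>] \<psi>(1) c by (auto simp: char_set_def)
  qed
qed

end

text \<open>The previous lemma with the two extensions exchanged. The fibre product in the other order is
  isomorphic to \<open>L\<close> through the flip of the kernel components.\<close>

lemma (in two_extensions) eps_image_supset_iff:
  "eps K (\<beta>, \<nu>) ` char_set B \<subseteq> eps K (\<alpha>, \<mu>) ` char_set A \<longleftrightarrow>
    (\<forall>b. ((\<one>\<^bsub>A\<^esub>, b), \<one>\<^bsub>K\<^esub>) \<in> Gamma2_set L \<longrightarrow> b = \<one>\<^bsub>B\<^esub>)"
proof -
  interpret sw: two_extensions K B \<beta> \<nu> A \<alpha> \<mu> by unfold_locales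
  let ?s = "map_prod prod.swap id :: ('a \<times> 'b) \<times> 'k \<Rightarrow> ('b \<times> 'a) \<times> 'k"
  have hom: "?s \<in> brace_hom L sw.L"
    by (rule brace_homI) auto
  have surj: "?s ` carrier L = carrier sw.L" by (force simp: image_iff)
  have "((b, \<one>\<^bsub>A\<^esub>), \<one>\<^bsub>K\<^esub>) \<in> Gamma2_set sw.L \<longleftrightarrow> ((\<one>\<^bsub>A\<^esub>, b), \<one>\<^bsub>K\<^esub>) \<in> Gamma2_set L" for b
    unfolding brace_hom_Gamma2_image[OF LL.G.skew_brace_axioms sw.LL.G.skew_brace_axioms hom surj, symmetric]
    by force
  then show ?thesis using sw.eps_image_subset_iff by simp
qed

context two_extensions
begin

section \<open>Compatible isomorphisms as graphs\<close>

text \<open>The equalizer of the two maps \<open>\<theta> \<circ> pG\<close> and \<open>pH\<close> on \<open>\<Gamma>\<^sub>2(L)\<close> is a subgroup, and compatibility says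
  that it contains the generators.\<close>

lemma Gamma2_fibre_product_in_graph:
  assumes \<theta>: "\<theta> \<in> brace_iso (Gamma2 G) (Gamma2 H)"
    and comp: "\<And>x y. x \<in> carrier K \<Longrightarrow> y \<in> carrier K \<Longrightarrow>
      \<theta> (commutator G (\<one>\<^bsub>A\<^esub>, x) (\<one>\<^bsub>A\<^esub>, y)) = commutator H (\<one>\<^bsub>B\<^esub>, x) (\<one>\<^bsub>B\<^esub>, y) \<and>
      \<theta> (star G (\<one>\<^bsub>A\<^esub>, x) (\<one>\<^bsub>A\<^esub>, y)) = star H (\<one>\<^bsub>B\<^esub>, x) (\<one>\<^bsub>B\<^esub>, y)"
    and d: "d \<in> Gamma2_set L"
  shows "\<theta> (pG d) = pH d"
proof -
  interpret SL: subgroup "Gamma2_set L" L by (rule LL.G.subgroup_Gamma2)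
  interpret SG: subgroup "Gamma2_set G" G by (rule GA.G.subgroup_Gamma2)
  interpret SH: subgroup "Gamma2_set H" H by (rule HB.G.subgroup_Gamma2)
  interpret g: group_hom L G pG using brace_homD(1)[OF pG_hom] by unfold_locales
  interpret h: group_hom L H pH using brace_homD(1)[OF pH_hom] by unfold_locales
  let ?\<Gamma>G = "G\<lparr>carrier := Gamma2_set G\<rparr>"
  have \<theta>hom: "\<theta> \<in> hom ?\<Gamma>G H"
    using \<theta> SH.subset by (auto simp: brace_iso_def Gamma2_def hom_def)
  have grp: "group ?\<Gamma>G" by (rule GA.G.subgroup_imp_group[OF GA.G.subgroup_Gamma2])
  interpret t: group_hom ?\<Gamma>G H \<theta>
    using \<theta>hom by (intro group_hom.intro group_hom_axioms.intro grp HB.G.is_group)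
  have pGin: "pG d \<in> Gamma2_set G" if "d \<in> Gamma2_set L" for d using that pG_Gamma2 by blast
  define E where "E = {d \<in> Gamma2_set L. \<theta> (pG d) = pH d}"
  have "subgroup E L"
  proof (rule LL.G.subgroupI)
    show "E \<subseteq> carrier L" using SL.subset by (auto simp: E_def)
    have "\<theta> (pG \<one>\<^bsub>L\<^esub>) = pH \<one>\<^bsub>L\<^esub>" using t.hom_one by (simp only: g.hom_one h.hom_one) simp
    then show "E \<noteq> {}" using SL.one_closed by (auto simp only: E_def)
    fix d assume "d \<in> E"
    then have d: "d \<in> Gamma2_set L" "d \<in> carrier L" "\<theta> (pG d) = pH d" using SL.subset by (auto simp: E_def)
    have "\<theta> (pG (inv\<^bsub>L\<^esub> d)) = \<theta> (inv\<^bsub>?\<Gamma>G\<^esub> pG d)"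
      using GA.G.m_inv_consistent[OF GA.G.subgroup_Gamma2 pGin[OF d(1)]] d(2) by (simp only: g.hom_inv)
    also have "\<dots> = inv\<^bsub>H\<^esub> (\<theta> (pG d))"
      using t.hom_inv[of "pG d"] pGin[OF d(1)] by simp
    also have "\<dots> = pH (inv\<^bsub>L\<^esub> d)" using d(2,3) by (simp only: h.hom_inv)
    finally show "inv\<^bsub>L\<^esub> d \<in> E" using d(1) SL.m_inv_closed by (simp add: E_def)
    fix e assume "e \<in> E"
    then have e: "e \<in> Gamma2_set L" "e \<in> carrier L" "\<theta> (pG e) = pH e" using SL.subset by (auto simp: E_def)
    have "\<theta> (pG (d \<otimes>\<^bsub>L\<^esub> e)) = \<theta> (pG d) \<otimes>\<^bsub>H\<^esub> \<theta> (pG e)"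
      using t.hom_mult[of "pG d" "pG e"] pGin[OF d(1)] pGin[OF e(1)] d(2) e(2)
      by (simp only: g.hom_mult) simp
    also have "\<dots> = pH (d \<otimes>\<^bsub>L\<^esub> e)" using d(2,3) e(2,3) by (simp only: h.hom_mult)
    finally show "d \<otimes>\<^bsub>L\<^esub> e \<in> E" using d(1) e(1) SL.m_closed by (simp add: E_def)
  qed
  moreover have "commutator L u v \<in> E \<and> star L u v \<in> E" if uv: "u \<in> carrier L" "v \<in> carrier L" for u v
  proof -
    obtain a b x where u: "u = ((a, b), x)" "a \<in> carrier A" "b \<in> carrier B" "x \<in> carrier K"
      using uv(1) by auto
    obtain a' b' y where v: "v = ((a', b'), y)" "a' \<in> carrier A" "b' \<in> carrier B" "y \<in> carrier K"
      using uv(2) by auto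
    note G = brace_hom_commutator_star[OF LL.G.skew_brace_axioms GA.G.skew_brace_axioms pG_hom uv]
    note H = brace_hom_commutator_star[OF LL.G.skew_brace_axioms HB.G.skew_brace_axioms pH_hom uv]
    have "\<theta> (pG (commutator L u v)) = pH (commutator L u v)"
      unfolding G H using comp[OF u(4) v(4)] u v
      by (simp add: GA.commutator_star_lift[of a a'] HB.commutator_star_lift[of b b'])
    moreover have "\<theta> (pG (star L u v)) = pH (star L u v)"
      unfolding G H using comp[OF u(4) v(4)] u v
      by (simp add: GA.commutator_star_lift[of a a'] HB.commutator_star_lift[of b b'])
    ultimately show ?thesis
      unfolding E_def using LL.G.commutator_in_Gamma2[OF uv] LL.G.star_in_Gamma2[OF uv] by blast
  qed
  ultimately have "Gamma2_set L \<subseteq> E" by (rule LL.G.Gamma2_minimal)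
  then show ?thesis using d by (auto simp: E_def)
qed

text \<open>Right to left, triviality of the two intersections makes both projections of \<open>\<Gamma>\<^sub>2(L)\<close> injective,
  and the isomorphism is one projection composed with the inverse of the other.\<close>

lemma iso_iff_Gamma2_meets_kernels_trivially:
  "(\<exists>\<theta> \<in> brace_iso (Gamma2 G) (Gamma2 H). \<forall>x\<in>carrier K. \<forall>y\<in>carrier K.
      \<theta> (commutator G (\<one>\<^bsub>A\<^esub>, x) (\<one>\<^bsub>A\<^esub>, y)) = commutator H (\<one>\<^bsub>B\<^esub>, x) (\<one>\<^bsub>B\<^esub>, y) \<and>
      \<theta> (star G (\<one>\<^bsub>A\<^esub>, x) (\<one>\<^bsub>A\<^esub>, y)) = star H (\<one>\<^bsub>B\<^esub>, x) (\<one>\<^bsub>B\<^esub>, y)) \<longleftrightarrow>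
    (\<forall>a. ((a, \<one>\<^bsub>B\<^esub>), \<one>\<^bsub>K\<^esub>) \<in> Gamma2_set L \<longrightarrow> a = \<one>\<^bsub>A\<^esub>) \<and>
    (\<forall>b. ((\<one>\<^bsub>A\<^esub>, b), \<one>\<^bsub>K\<^esub>) \<in> Gamma2_set L \<longrightarrow> b = \<one>\<^bsub>B\<^esub>)" (is "?iso \<longleftrightarrow> ?triv")
proof
  assume ?iso
  then obtain \<theta> where \<theta>: "\<theta> \<in> brace_iso (Gamma2 G) (Gamma2 H)"
    and graph: "\<And>d. d \<in> Gamma2_set L \<Longrightarrow> \<theta> (pG d) = pH d"
    using Gamma2_fibre_product_in_graph by blast
  have inj: "inj_on \<theta> (Gamma2_set G)"
    using \<theta> by (auto simp: brace_iso_def Gamma2_def bij_betw_def)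
  have one: "\<one>\<^bsub>L\<^esub> \<in> Gamma2_set L" by (rule subgroup.one_closed[OF LL.G.subgroup_Gamma2])
  have pGin: "pG d \<in> Gamma2_set G" if "d \<in> Gamma2_set L" for d using that pG_Gamma2 by blast
  have \<theta>1: "\<theta> (\<one>\<^bsub>A\<^esub>, \<one>\<^bsub>K\<^esub>) = (\<one>\<^bsub>B\<^esub>, \<one>\<^bsub>K\<^esub>)" and 1: "(\<one>\<^bsub>A\<^esub>, \<one>\<^bsub>K\<^esub>) \<in> Gamma2_set G"
    using graph[OF one] pGin[OF one] by simp_all
  show ?triv
  proof (intro conjI allI impI)
    fix a assume a: "((a, \<one>\<^bsub>B\<^esub>), \<one>\<^bsub>K\<^esub>) \<in> Gamma2_set L"
    then have "\<theta> (a, \<one>\<^bsub>K\<^esub>) = \<theta> (\<one>\<^bsub>A\<^esub>, \<one>\<^bsub>K\<^esub>)" using graph[OF a] \<theta>1 by simp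
    then show "a = \<one>\<^bsub>A\<^esub>" using inj_onD[OF inj] pGin[OF a] 1 by fastforce
  next
    fix b assume b: "((\<one>\<^bsub>A\<^esub>, b), \<one>\<^bsub>K\<^esub>) \<in> Gamma2_set L"
    then show "b = \<one>\<^bsub>B\<^esub>" using graph[OF b] \<theta>1 by simp
  qed
next
  assume triv: ?triv
  let ?D = "Gamma2_set L"
  interpret SL: subgroup ?D L by (rule LL.G.subgroup_Gamma2)
  have injG: "inj_on pG ?D"
  proof (rule inj_on_subgroup_if_trivial_kernel[OF LL.G.is_group GA.G.is_group brace_homD(1)[OF pG_hom] SL.subgroup_axioms])
    fix d assume "d \<in> ?D" "pG d = \<one>\<^bsub>G\<^esub>"
    then obtain a b where d: "d = ((a, b), \<one>\<^bsub>K\<^esub>)" by (cases d) auto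
    have "a = \<one>\<^bsub>A\<^esub>" using \<open>pG d = _\<close> d by simp
    moreover from this have "b = \<one>\<^bsub>B\<^esub>" using triv \<open>d \<in> ?D\<close> d by blast
    ultimately show "d = \<one>\<^bsub>L\<^esub>" using d by simp
  qed
  have injH: "inj_on pH ?D"
  proof (rule inj_on_subgroup_if_trivial_kernel[OF LL.G.is_group HB.G.is_group brace_homD(1)[OF pH_hom] SL.subgroup_axioms])
    fix d assume "d \<in> ?D" "pH d = \<one>\<^bsub>H\<^esub>"
    then obtain a b where d: "d = ((a, b), \<one>\<^bsub>K\<^esub>)" by (cases d) auto
    have "b = \<one>\<^bsub>B\<^esub>" using \<open>pH d = _\<close> d by simp
    moreover from this have "a = \<one>\<^bsub>A\<^esub>" using triv \<open>d \<in> ?D\<close> d by blast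
    ultimately show "d = \<one>\<^bsub>L\<^esub>" using d by simp
  qed
  define \<theta> where "\<theta> = pH \<circ> inv_into ?D pG"
  have \<theta>: "\<theta> (pG d) = pH d" if "d \<in> ?D" for d
    using inv_into_f_f[OF injG that] by (simp add: \<theta>_def)
  have D: "d \<in> carrier L" if "d \<in> ?D" for d using that by (rule SL.mem_carrier)
  have lift: "\<exists>d\<in>?D. g = pG d" if "g \<in> Gamma2_set G" for g
    using that unfolding pG_Gamma2[symmetric] by (elim imageE) (rule bexI)
  have "bij_betw \<theta> (Gamma2_set G) (Gamma2_set H)"
    unfolding \<theta>_def using injG injH pG_Gamma2 pH_Gamma2
    by (intro bij_betw_trans[of _ _ ?D] bij_betw_inv_into) (auto simp: bij_betw_def)
  moreover have "\<theta> (g \<otimes>\<^bsub>G\<^esub> g') = \<theta> g \<otimes>\<^bsub>H\<^esub> \<theta> g' \<and> \<theta> (g \<circledcirc>\<^bsub>G\<^esub> g') = \<theta> g \<circledcirc>\<^bsub>H\<^esub> \<theta> g'"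
    if gg: "g \<in> Gamma2_set G" "g' \<in> Gamma2_set G" for g g'
  proof -
    obtain d d' where d: "d \<in> ?D" "d' \<in> ?D" and g: "g = pG d" "g' = pG d'" using lift gg by blast
    note c = D[OF d(1)] D[OF d(2)]
    have "\<theta> (g \<otimes>\<^bsub>G\<^esub> g') = \<theta> (pG (d \<otimes>\<^bsub>L\<^esub> d'))"
      unfolding g by (simp only: brace_homD(3)[OF pG_hom c])
    also have "\<dots> = \<theta> g \<otimes>\<^bsub>H\<^esub> \<theta> g'"
      unfolding g \<theta>[OF SL.m_closed[OF d]] \<theta>[OF d(1)] \<theta>[OF d(2)] by (rule brace_homD(3)[OF pH_hom c])
    finally have m: "\<theta> (g \<otimes>\<^bsub>G\<^esub> g') = \<theta> g \<otimes>\<^bsub>H\<^esub> \<theta> g'" .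
    have "\<theta> (g \<circledcirc>\<^bsub>G\<^esub> g') = \<theta> (pG (d \<circledcirc>\<^bsub>L\<^esub> d'))"
      unfolding g by (simp only: brace_homD(4)[OF pG_hom c])
    also have "\<dots> = \<theta> g \<circledcirc>\<^bsub>H\<^esub> \<theta> g'"
      unfolding g \<theta>[OF LL.G.Gamma2_circ_closed[OF d]] \<theta>[OF d(1)] \<theta>[OF d(2)]
      by (rule brace_homD(4)[OF pH_hom c])
    finally show ?thesis using m by simp
  qed
  ultimately have "\<theta> \<in> brace_iso (Gamma2 G) (Gamma2 H)"
    by (auto simp: brace_iso_def Gamma2_def hom_def circ_group_def bij_betw_def)
  moreover have "\<theta> (commutator G (\<one>\<^bsub>A\<^esub>, x) (\<one>\<^bsub>A\<^esub>, y)) = commutator H (\<one>\<^bsub>B\<^esub>, x) (\<one>\<^bsub>B\<^esub>, y) \<and>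
      \<theta> (star G (\<one>\<^bsub>A\<^esub>, x) (\<one>\<^bsub>A\<^esub>, y)) = star H (\<one>\<^bsub>B\<^esub>, x) (\<one>\<^bsub>B\<^esub>, y)"
    if xy: "x \<in> carrier K" "y \<in> carrier K" for x y
  proof -
    let ?u = "((\<one>\<^bsub>A\<^esub>, \<one>\<^bsub>B\<^esub>), x)" and ?v = "((\<one>\<^bsub>A\<^esub>, \<one>\<^bsub>B\<^esub>), y)"
    have uv: "?u \<in> carrier L" "?v \<in> carrier L" using xy by simp_all
    note G = brace_hom_commutator_star[OF LL.G.skew_brace_axioms GA.G.skew_brace_axioms pG_hom uv]
    note H = brace_hom_commutator_star[OF LL.G.skew_brace_axioms HB.G.skew_brace_axioms pH_hom uv]
    show ?thesis
      using \<theta>[OF LL.G.commutator_in_Gamma2[OF uv]] \<theta>[OF LL.G.star_in_Gamma2[OF uv]]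
      unfolding G H by simp
  qed
  ultimately show ?iso by blast
qed

end

section \<open>Compatible isomorphisms and equality of the images of \<open>\<epsilon>\<close>\<close>

theorem theorem3p9:
  fixes K :: "'k sbrace" and A :: "'a monoid" and B :: "'b monoid"
    and \<alpha> \<mu> :: "'k \<times> 'k \<Rightarrow> 'a" and \<beta> \<nu> :: "'k \<times> 'k \<Rightarrow> 'b"
    and G :: "('a \<times> 'k) sbrace" and H :: "('b \<times> 'k) sbrace"
    and \<xi> :: "('a \<times> 'k) set \<Rightarrow> ('b \<times> 'k) set"
  assumes "skew_brace K" and "finite (carrier K)"
    and "comm_group A" and "comm_group B"
    and "(\<alpha>, \<mu>) \<in> carrier (Z2b K A)" and "(\<beta>, \<nu>) \<in> carrier (Z2b K B)"
    and "G = brace_ext A (\<alpha>, \<mu>) K" and "H = brace_ext B (\<beta>, \<nu>) K"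
    and "\<xi> \<in> brace_iso (quot_brace G (ext_kernel A K)) (quot_brace H (ext_kernel B K))"
    and "\<forall>k\<in>carrier K. \<xi> (ext_kernel A K #>\<^bsub>G\<^esub> (\<one>\<^bsub>A\<^esub>, k)) = ext_kernel B K #>\<^bsub>H\<^esub> (\<one>\<^bsub>B\<^esub>, k)"
  shows "(\<exists>\<theta> \<in> brace_iso (Gamma2 G) (Gamma2 H).
            \<forall>p \<in> carrier (quot_brace G (ext_kernel A K)) \<times> carrier (quot_brace G (ext_kernel A K)).
              (\<theta> \<circ> phi_comm G) p = (phi_comm H \<circ> map_prod \<xi> \<xi>) p \<and>
              (\<theta> \<circ> phi_star G) p = (phi_star H \<circ> map_prod \<xi> \<xi>) p)
         \<longleftrightarrow> eps K (\<alpha>, \<mu>) ` char_set A = eps K (\<beta>, \<nu>) ` char_set B"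
proof -
  interpret two_extensions K A \<alpha> \<mu> B \<beta> \<nu>
    using assms(1,3-6) by (intro two_extensions.intro central_extension.intro) (auto simp: Z2b_def)
  \<comment> \<open>By the hypothesis on \<open>\<xi>\<close>, compatibility only involves the transversal elements \<open>(1, x)\<close>.\<close>
  have "(\<forall>p \<in> carrier (quot_brace G (ext_kernel A K)) \<times> carrier (quot_brace G (ext_kernel A K)).
          (\<theta> \<circ> phi_comm G) p = (phi_comm H \<circ> map_prod \<xi> \<xi>) p \<and>
          (\<theta> \<circ> phi_star G) p = (phi_star H \<circ> map_prod \<xi> \<xi>) p) \<longleftrightarrow>
      (\<forall>x\<in>carrier K. \<forall>y\<in>carrier K.
        \<theta> (commutator G (\<one>\<^bsub>A\<^esub>, x) (\<one>\<^bsub>A\<^esub>, y)) = commutator H (\<one>\<^bsub>B\<^esub>, x) (\<one>\<^bsub>B\<^esub>, y) \<and>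
        \<theta> (star G (\<one>\<^bsub>A\<^esub>, x) (\<one>\<^bsub>A\<^esub>, y)) = star H (\<one>\<^bsub>B\<^esub>, x) (\<one>\<^bsub>B\<^esub>, y))" for \<theta>
    using assms(10) unfolding assms(7,8) GA.carrier_quot
    by (simp add: GA.phi_lift HB.phi_lift cong: ball_cong)
  then show ?thesis
    using iso_iff_Gamma2_meets_kernels_trivially eps_image_subset_iff eps_image_supset_iff
    unfolding assms(7,8) by (simp add: set_eq_subset)
qed

end
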